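(* Let $G$ be a locally countable Borel graph on a standard Borel space $X$ and let $\mathfrak{w} : E_G \to \mathbb{R}^+$ be a Borel cocycle. If $G$ has finite $\mathfrak{w}$-visibility, then $G$ is (Borel) hyperfinite.
   Context: A graph on $X$ is a symmetric subset of $X^2$; it is locally countable if every vertex has countably many neighbors. $E_G$ is the equivalence relation of lying in the same $G$-connected component. A cocycle $\mathfrak{w}:E_G\to\mathbb{R}^+=(0,\infty)$, $(x,y)\mapsto\mathfrak{w}_x(y)$, satisfies $\mathfrak{w}_x(y)\mathfrak{w}_y(z)=\mathfrak{w}_x(z)$ for all $E_G$-related $x,y,z$. A set $V\subseteq X$ is $G$-connected if $G\cap V^2$ is a connected graph on $V$. A $(G,\mathfrak{w})$-visible neighborhood of $x\in X$ is a $G$-connected set $V\ni x$ with $\mathfrak{w}_x(v)\le 1$ for each $v\in V$. Write $y\preccurlyeq x$ if some $(G,\mathfrak{w})$-visible neighborhood of $x$ contains $y$. $G$ has finite $\mathfrak{w}$-visibility if $\sum_{y\preccurlyeq x}\mathfrak{w}_x(y)<\infty$ for every $x\in X$. $G$ is hyperfinite if $E_G$ is an increasing union of countably many Borel equivalence relations with finite classes. *)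

theory Defs
  imports "HOL-Analysis.Analysis"
begin

text \<open>Only the \<open>\<sigma>\<close>-algebra of the measure \<open>M\<close> is used below: it stands for the
  measurable space with points \<open>space M\<close> and Borel sets \<open>sets M\<close>.\<close>

definition standard_borel :: "'a measure \<Rightarrow> bool" where
  "standard_borel M \<longleftrightarrow>
     (\<exists>T. completely_metrizable_space T \<and> second_countable T \<and>
          topspace T = space M \<and> sets M = sigma_sets (space M) {U. openin T U})"

text \<open>As a graph is merely a symmetric relation, loops are permitted.\<close>

definition borel_graph :: "'a measure \<Rightarrow> ('a \<times> 'a) set \<Rightarrow> bool" where
  "borel_graph M G \<longleftrightarrow> G \<in> sets (M \<Otimes>\<^sub>M M) \<and> sym G"

definition locally_countable :: "'a measure \<Rightarrow> ('a \<times> 'a) set \<Rightarrow> bool" where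
  "locally_countable M G \<longleftrightarrow> (\<forall>x\<in>space M. countable (G `` {x}))"

text \<open>The reflexive transitive closure is reflexive on the whole type, hence the
  restriction to the vertex set \<open>X\<close>.\<close>

definition conn_rel :: "'a set \<Rightarrow> ('a \<times> 'a) set \<Rightarrow> ('a \<times> 'a) set" where
  "conn_rel X G = G\<^sup>* \<inter> X \<times> X"

text \<open>A cocycle is a function on \<open>E\<close> only; the value \<open>w x y\<close> stands for \<open>w\<^sub>x(y)\<close> and is
  irrelevant for \<open>(x, y) \<notin> E\<close>.\<close>

definition cocycle :: "('a \<times> 'a) set \<Rightarrow> ('a \<Rightarrow> 'a \<Rightarrow> real) \<Rightarrow> bool" where
  "cocycle E w \<longleftrightarrow>
     (\<forall>(x, y)\<in>E. 0 < w x y) \<and>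
     (\<forall>x y z. (x, y) \<in> E \<and> (y, z) \<in> E \<longrightarrow> w x y * w y z = w x z)"

definition borel_cocycle ::
    "'a measure \<Rightarrow> ('a \<times> 'a) set \<Rightarrow> ('a \<Rightarrow> 'a \<Rightarrow> real) \<Rightarrow> bool" where
  "borel_cocycle M E w \<longleftrightarrow>
     cocycle E w \<and>
     (\<lambda>(x, y). w x y) \<in> borel_measurable (restrict_space (M \<Otimes>\<^sub>M M) E)"

definition graph_connected :: "('a \<times> 'a) set \<Rightarrow> 'a set \<Rightarrow> bool" where
  "graph_connected G V \<longleftrightarrow> (\<forall>u\<in>V. \<forall>v\<in>V. (u, v) \<in> (G \<inter> V \<times> V)\<^sup>*)"

definition visible_nbhd ::
    "'a set \<Rightarrow> ('a \<times> 'a) set \<Rightarrow> ('a \<Rightarrow> 'a \<Rightarrow> real) \<Rightarrow> 'a \<Rightarrow> 'a set \<Rightarrow> bool" where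
  "visible_nbhd X G w x V \<longleftrightarrow>
     V \<subseteq> X \<and> x \<in> V \<and> graph_connected G V \<and> (\<forall>v\<in>V. w x v \<le> 1)"

text \<open>\<open>visible_from X G w x y\<close> is \<open>y \<preceq> x\<close>.\<close>

definition visible_from ::
    "'a set \<Rightarrow> ('a \<times> 'a) set \<Rightarrow> ('a \<Rightarrow> 'a \<Rightarrow> real) \<Rightarrow> 'a \<Rightarrow> 'a \<Rightarrow> bool" where
  "visible_from X G w x y \<longleftrightarrow> (\<exists>V. visible_nbhd X G w x V \<and> y \<in> V)"

definition finite_visibility ::
    "'a set \<Rightarrow> ('a \<times> 'a) set \<Rightarrow> ('a \<Rightarrow> 'a \<Rightarrow> real) \<Rightarrow> bool" where
  "finite_visibility X G w \<longleftrightarrow>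
     (\<forall>x\<in>X. (\<lambda>y. w x y) summable_on {y. visible_from X G w x y})"

definition hyperfinite_graph :: "'a measure \<Rightarrow> ('a \<times> 'a) set \<Rightarrow> bool" where
  "hyperfinite_graph M G \<longleftrightarrow>
     (\<exists>F :: nat \<Rightarrow> ('a \<times> 'a) set.
        (\<forall>n. F n \<in> sets (M \<Otimes>\<^sub>M M) \<and> equiv (space M) (F n) \<and>
             (\<forall>x\<in>space M. finite (F n `` {x}))) \<and>
        incseq F \<and>
        conn_rel (space M) G = (\<Union>n. F n))"

end

theory Submission
  imports Defs "HOL-Library.Fun_Lexorder"
begin

text \<open>Call \<open>y\<close> visible from \<open>x\<close> if \<open>y\<close> lies in the component of \<open>x\<close> in the sublevel set of
  \<open>w\<close> at \<open>x\<close>. Two such components that meet are nested, so the points that see a given point are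
  linearly preordered by visibility; by finite visibility every interval of this preorder is
  finite, and any two connected points are visible from a common one. After breaking ties, each
  component of \<open>G\<close> thus becomes a directed forest order whose upward chains have order type at
  most \<open>\<omega>\<close>. Markers that are cofinal in every chain and vanish in the limit then send each point to
  the first marker above it; these maps present the connectedness relation as an increasing union
  of smooth countable relations, and numbering the subclasses inside each class turns that union
  into one of finite relations. Measurability of everything that quantifies over neighbours rests on
  the Lusin--Novikov theorem, which is derived here from Lusin separation and a Baire category
  argument.\<close>


section \<open>Analytic sets\<close>

text \<open>On one component the cocycle identity gives \<open>w x v\<close> the form f(v)/f(x), so
  the sublevel set at x is {f <= f(x)}. Raising the threshold only merges components of such sets;
  this is the source of the forest. Intervals are finite because, seen from the top, all their
  points weigh at least as much as the bottom point, and the visible weights are summable. The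
  obstacle is that no point of a class can be chosen in a Borel way. Markers can be steered only by
  questions with the same answer throughout a class, such as whether a set is cofinal. Sets shrunk
  in this way may still close in on one point, which must be deleted for the markers to vanish; a
  last point of a chain, on the other hand, has to stay a marker for ever. The vertex type carries
  no topology, so points are coded by real sequences. There Lusin--Novikov yields countably many
  maps that enumerate neighbours; words in these maps enumerate components, and every quantifier
  over a component becomes a countable one.\<close>

text \<open>The codes form a closed subset of Baire space instead of all of it: the empty set is
  then no exception, and closed conditions on points can be imposed directly on codes.\<close>

definition analytic :: "'a::topological_space set \<Rightarrow> bool" where
  "analytic A \<longleftrightarrow> (\<exists>(C :: (nat \<Rightarrow> nat) set) f. closed C \<and> continuous_on C f \<and> f ` C = A)"

lemma analyticI:
  fixes C :: "(nat \<Rightarrow> nat) set"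
  assumes "closed C" "continuous_on C f" "f ` C = A"
  shows "analytic A"
  using assms unfolding analytic_def by blast

lemma analyticE:
  assumes "analytic A"
  obtains C :: "(nat \<Rightarrow> nat) set" and f where "closed C" "continuous_on C f" "f ` C = A"
  using assms unfolding analytic_def by blast

lemma analytic_image:
  assumes "analytic A" "continuous_on A g"
  shows "analytic (g ` A)"
proof -
  from assms(1) obtain C :: "(nat \<Rightarrow> nat) set" and f
    where "closed C" "continuous_on C f" "f ` C = A" by (rule analyticE)
  then show ?thesis
    using assms(2) by (intro analyticI[of C "g \<circ> f"] continuous_on_compose) auto
qed

lemma continuous_on_reindex:
  fixes r :: "'i \<Rightarrow> 'j"
  shows "continuous_on S (\<lambda>\<alpha> :: 'j \<Rightarrow> 'b::topological_space. (\<lambda>i. \<alpha> (r i)))"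
  by (rule continuous_on_coordinatewise_then_product)
     (rule continuous_on_subset[OF continuous_on_product_coordinates subset_UNIV])

lemma closed_reindex_vimage:
  fixes r :: "'i \<Rightarrow> 'j" and C :: "('i \<Rightarrow> 'b::topological_space) set"
  assumes "closed C"
  shows "closed {\<alpha>. (\<lambda>i. \<alpha> (r i)) \<in> C}"
  using closed_vimage[OF assms continuous_on_reindex[of UNIV r]] by (simp add: vimage_def)

text \<open>A code of a pair interleaves codes of its entries at the even and the odd
  positions.\<close>

lemma analytic_Times:
  assumes "analytic A" "analytic B"
  shows "analytic (A \<times> B)"
proof -
  from assms(1) obtain C :: "(nat \<Rightarrow> nat) set" and f
    where f: "closed C" "continuous_on C f" "f ` C = A" by (rule analyticE)
  from assms(2) obtain D :: "(nat \<Rightarrow> nat) set" and g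
    where g: "closed D" "continuous_on D g" "g ` D = B" by (rule analyticE)
  let ?l = "\<lambda>\<alpha> :: nat \<Rightarrow> nat. \<lambda>i. \<alpha> (2 * i)" and ?r = "\<lambda>\<alpha> :: nat \<Rightarrow> nat. \<lambda>i. \<alpha> (Suc (2 * i))"
  let ?S = "{\<alpha>. ?l \<alpha> \<in> C} \<inter> {\<alpha>. ?r \<alpha> \<in> D}"
  let ?h = "\<lambda>\<alpha>. (f (?l \<alpha>), g (?r \<alpha>))"
  have "continuous_on ?S ?h"
    by (intro continuous_on_Pair continuous_on_compose2[OF f(2) continuous_on_reindex]
        continuous_on_compose2[OF g(2) continuous_on_reindex]) auto
  moreover have "closed ?S"
    by (intro closed_Int closed_reindex_vimage f g)
  moreover have "?h ` ?S = A \<times> B"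
  proof (intro equalityI subsetI)
    fix p assume "p \<in> A \<times> B"
    then obtain \<alpha> \<beta> where ab: "\<alpha> \<in> C" "\<beta> \<in> D" "p = (f \<alpha>, g \<beta>)"
      using f(3) g(3) by blast
    define \<gamma> where "\<gamma> = (\<lambda>n. if even n then \<alpha> (n div 2) else \<beta> (n div 2))"
    have "?l \<gamma> = \<alpha>" "?r \<gamma> = \<beta>"
      by (auto simp: \<gamma>_def)
    then show "p \<in> ?h ` ?S"
      using ab by (intro image_eqI[of _ _ \<gamma>]) auto
  qed (use f(3) g(3) in auto)
  ultimately show ?thesis by (intro analyticI)
qed

text \<open>The first digit of a code names the set, the other digits code a point of it. That digit
  is locally constant, so continuity can be checked for one \<open>f n\<close> at a time.\<close>

lemma analytic_UN:
  assumes "\<And>n :: nat. analytic (A n)"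
  shows "analytic (\<Union>n. A n)"
proof -
  obtain C :: "nat \<Rightarrow> (nat \<Rightarrow> nat) set" and f
    where f: "\<And>n. closed (C n)" "\<And>n. continuous_on (C n) (f n)" "\<And>n. f n ` C n = A n"
    using assms unfolding analytic_def by metis
  let ?t = "\<lambda>\<alpha> :: nat \<Rightarrow> nat. \<lambda>i. \<alpha> (Suc i)"
  \<comment> \<open>The condition \<open>?t \<alpha> \<in> C (\<alpha> 0)\<close>, spelled out as
    one implication per possible first digit, is visibly closed.\<close>
  let ?S = "\<Inter>n. ({\<alpha>. \<alpha> 0 \<noteq> n} \<union> {\<alpha>. ?t \<alpha> \<in> C n})"
  let ?h = "\<lambda>\<alpha>. f (\<alpha> 0) (?t \<alpha>)"
  have op: "open {\<alpha> :: nat \<Rightarrow> nat. \<alpha> 0 = n}" for n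
    using open_vimage[OF open_discrete[of "{n}"] continuous_on_product_coordinates[of "0::nat"]]
    by (simp add: vimage_def)
  have "closed {\<alpha> :: nat \<Rightarrow> nat. \<alpha> 0 \<noteq> n}" for n
    using op[of n] by (simp add: closed_def Compl_eq)
  then have "closed ?S"
    by (intro closed_INT ballI closed_Un closed_reindex_vimage f)
  moreover have "continuous_on ?S ?h"
    unfolding continuous_on_topological
  proof (intro ballI allI impI)
    fix \<alpha> B assume \<alpha>: "\<alpha> \<in> ?S" and B: "open B" "f (\<alpha> 0) (?t \<alpha>) \<in> B"
    have "continuous_on {\<beta>. ?t \<beta> \<in> C (\<alpha> 0)} (\<lambda>\<beta>. f (\<alpha> 0) (?t \<beta>))"
      by (rule continuous_on_compose2[where f = ?t, OF f(2)[of "\<alpha> 0"] continuous_on_reindex[of _ Suc]])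
         (simp add: image_subset_iff)
    moreover have "\<alpha> \<in> {\<beta>. ?t \<beta> \<in> C (\<alpha> 0)}"
      using \<alpha> by auto
    ultimately obtain U where U: "open U" "\<alpha> \<in> U"
        "\<And>\<beta>. ?t \<beta> \<in> C (\<alpha> 0) \<Longrightarrow> \<beta> \<in> U \<Longrightarrow> f (\<alpha> 0) (?t \<beta>) \<in> B"
      using B unfolding continuous_on_topological mem_Collect_eq Ball_def by metis
    show "\<exists>U. open U \<and> \<alpha> \<in> U \<and> (\<forall>\<beta>\<in>?S. \<beta> \<in> U \<longrightarrow> ?h \<beta> \<in> B)"
      using U op[of "\<alpha> 0"] by (intro exI[of _ "U \<inter> {\<beta>. \<beta> 0 = \<alpha> 0}"]) auto
  qed
  moreover have "?h ` ?S = (\<Union>n. A n)"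
  proof (intro equalityI subsetI)
    fix p assume "p \<in> (\<Union>n. A n)"
    then obtain n \<alpha> where "\<alpha> \<in> C n" "p = f n \<alpha>"
      using f(3) by blast
    then show "p \<in> ?h ` ?S"
      by (intro image_eqI[of _ _ "case_nat n \<alpha>"]) auto
  qed (use f(3) in blast)
  ultimately show ?thesis by (intro analyticI)
qed

text \<open>One code carries a code for every \<open>A n\<close> along the pairing function. That
  all of them name the same point is a closed condition, expressed by vanishing distances.\<close>

lemma analytic_INT:
  fixes A :: "nat \<Rightarrow> 'a::metric_space set"
  assumes "\<And>n. analytic (A n)"
  shows "analytic (\<Inter>n. A n)"
proof -
  obtain C :: "nat \<Rightarrow> (nat \<Rightarrow> nat) set" and f
    where f: "\<And>n. closed (C n)" "\<And>n. continuous_on (C n) (f n)" "\<And>n. f n ` C n = A n"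
    using assms unfolding analytic_def by metis
  let ?t = "\<lambda>n. \<lambda>\<alpha> :: nat \<Rightarrow> nat. \<lambda>i. \<alpha> (prod_encode (n, i))"
  let ?D = "\<Inter>n. {\<alpha>. ?t n \<alpha> \<in> C n}"
  let ?S = "\<Inter>n. {\<alpha> \<in> ?D. dist (f n (?t n \<alpha>)) (f 0 (?t 0 \<alpha>)) \<le> 0}"
  have D: "closed ?D"
    by (intro closed_INT ballI closed_reindex_vimage f)
  have c: "continuous_on ?D (\<lambda>\<alpha>. f n (?t n \<alpha>))" for n
    by (rule continuous_on_compose2[OF f(2)[of n] continuous_on_reindex[of _ "\<lambda>i. prod_encode (n, i)"]])
       auto
  have "closed ?S"
    by (intro closed_INT ballI continuous_on_closed_Collect_le continuous_on_dist c D
        continuous_on_const)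
  moreover have "continuous_on ?S (\<lambda>\<alpha>. f 0 (?t 0 \<alpha>))"
    by (rule continuous_on_subset[OF c]) auto
  moreover have "(\<lambda>\<alpha>. f 0 (?t 0 \<alpha>)) ` ?S = (\<Inter>n. A n)"
  proof (intro equalityI subsetI)
    fix p assume "p \<in> (\<Inter>n. A n)"
    then have "\<forall>n. \<exists>\<alpha>. \<alpha> \<in> C n \<and> p = f n \<alpha>"
      using f(3) by blast
    then obtain a where a: "\<And>n. a n \<in> C n" "\<And>n. p = f n (a n)"
      by metis
    define \<gamma> where "\<gamma> = (\<lambda>k. case prod_decode k of (n, i) \<Rightarrow> a n i)"
    have "?t n \<gamma> = a n" for n
      by (auto simp: \<gamma>_def)
    then show "p \<in> (\<lambda>\<alpha>. f 0 (?t 0 \<alpha>)) ` ?S"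
      using a by (intro image_eqI[of _ _ \<gamma>]) (auto simp flip: a(2))
  next
    fix p assume "p \<in> (\<lambda>\<alpha>. f 0 (?t 0 \<alpha>)) ` ?S"
    then obtain \<alpha> where "\<alpha> \<in> ?S" "p = f 0 (?t 0 \<alpha>)" by blast
    then have "?t n \<alpha> \<in> C n" "f n (?t n \<alpha>) = p" for n
      by auto
    then show "p \<in> (\<Inter>n. A n)"
      using f(3) by (metis INT_I imageI)
  qed
  ultimately show ?thesis by (intro analyticI)
qed

lemma analytic_Int:
  fixes A B :: "'a::metric_space set"
  assumes "analytic A" "analytic B"
  shows "analytic (A \<inter> B)"
proof -
  have "analytic (\<Inter>n. if n = (0::nat) then A else B)"
    using assms by (intro analytic_INT) simp
  moreover have "(\<Inter>n. if n = (0::nat) then A else B) = A \<inter> B"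
    by (auto split: if_splits)
  ultimately show ?thesis by metis
qed

text \<open>Codes are index sequences into a dense sequence whose consecutive distances are at most
  (1/2)^n. They converge at a uniform rate, so the limit depends continuously on the code.\<close>

lemma analytic_UNIV: "analytic (UNIV :: 'a::{complete_space,second_countable_topology} set)"
proof -
  obtain D :: "'a set" where D: "countable D" "\<And>X. open X \<Longrightarrow> X \<noteq> {} \<Longrightarrow> \<exists>d\<in>D. d \<in> X"
    using countable_dense_exists by blast
  define d where "d = from_nat_into D"
  have "D \<noteq> {}"
    using D(2)[of UNIV] by auto
  then have d: "\<exists>n. d n \<in> X" if "open X" "X \<noteq> {}" for X
    using D(2)[OF that] from_nat_into_surj[OF D(1)] unfolding d_def by blast
  let ?C = "\<Inter>n. {\<alpha> :: nat \<Rightarrow> nat. dist (d (\<alpha> n)) (d (\<alpha> (Suc n))) \<le> (1/2) ^ n}"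
  let ?f = "\<lambda>\<alpha>. lim (\<lambda>n. d (\<alpha> n))"
  have cd: "continuous_on S (\<lambda>\<alpha>. d (\<alpha> n))" for S and n :: nat
    by (rule continuous_on_compose2[OF Topological_Spaces.continuous_on_discrete[of UNIV]
          continuous_on_subset[OF continuous_on_product_coordinates subset_UNIV]]) simp
  have "closed ?C"
    by (intro closed_INT ballI closed_Collect_le continuous_on_dist cd continuous_on_const)
  have step: "dist (d (\<alpha> m)) (d (\<alpha> (m + k))) \<le> 2 * (1/2) ^ m - 2 * (1/2) ^ (m + k)"
    if "\<alpha> \<in> ?C" for \<alpha> m k
  proof (induction k)
    case (Suc k)
    have "dist (d (\<alpha> (m + k))) (d (\<alpha> (m + Suc k))) \<le> (1/2) ^ (m + k)"
      using that by auto
    then show ?case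
      using Suc dist_triangle[of "d (\<alpha> m)" "d (\<alpha> (m + Suc k))" "d (\<alpha> (m + k))"] by simp
  qed simp
  have le: "dist (d (\<alpha> m)) (d (\<alpha> n)) \<le> 2 * (1/2) ^ m" if "\<alpha> \<in> ?C" "m \<le> n" for \<alpha> m n
    using step[OF that(1), of m "n - m"] that(2)
    by (smt (verit, ccfv_threshold) le_add_diff_inverse zero_le_power divide_nonneg_nonneg)
  have lim0: "(\<lambda>n. 2 * (1/2) ^ n :: real) \<longlonglongrightarrow> 0"
    by (intro tendsto_mult_right_zero LIMSEQ_realpow_zero) auto
  have conv: "(\<lambda>n. d (\<alpha> n)) \<longlonglongrightarrow> ?f \<alpha>" if \<alpha>: "\<alpha> \<in> ?C" for \<alpha>
  proof -
    have "Cauchy (\<lambda>n. d (\<alpha> n))"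
    proof (rule metric_CauchyI)
      fix e :: real assume "0 < e"
      then obtain N where N: "2 * (1/2) ^ N < e / 2"
        using LIMSEQ_D[OF lim0, of "e/2"] by auto
      have "dist (d (\<alpha> m)) (d (\<alpha> n)) < e" if "N \<le> m" "N \<le> n" for m n
        using le[OF \<alpha> that(1)] le[OF \<alpha> that(2)] N
          dist_triangle2[of "d (\<alpha> m)" "d (\<alpha> n)" "d (\<alpha> N)"] by (simp add: dist_commute)
      then show "\<exists>M. \<forall>m\<ge>M. \<forall>n\<ge>M. dist (d (\<alpha> m)) (d (\<alpha> n)) < e" by blast
    qed
    then show ?thesis
      using Cauchy_convergent convergent_LIMSEQ_iff by blast
  qed
  have bound: "dist (d (\<alpha> n)) (?f \<alpha>) \<le> 2 * (1/2) ^ n" if "\<alpha> \<in> ?C" for \<alpha> n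
  proof (rule LIMSEQ_le_const2)
    show "(\<lambda>k. dist (d (\<alpha> n)) (d (\<alpha> k))) \<longlonglongrightarrow> dist (d (\<alpha> n)) (?f \<alpha>)"
      by (intro tendsto_dist tendsto_const conv that)
  qed (use le[OF that] in blast)
  have "continuous_on ?C ?f"
  proof (rule uniform_limit_theorem)
    show "\<forall>\<^sub>F n in sequentially. continuous_on ?C (\<lambda>\<alpha>. d (\<alpha> n))"
      using cd by simp
    show "uniform_limit ?C (\<lambda>n \<alpha>. d (\<alpha> n)) ?f sequentially"
    proof (rule uniform_limitI)
      fix e :: real assume "0 < e"
      then have "\<forall>\<^sub>F n in sequentially. 2 * (1/2) ^ n < e"
        using order_tendstoD(2)[OF lim0] by blast
      then show "\<forall>\<^sub>F n in sequentially. \<forall>\<alpha>\<in>?C. dist (d (\<alpha> n)) (?f \<alpha>) < e"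
        by eventually_elim (use bound in \<open>meson le_less_trans\<close>)
    qed
  qed simp
  moreover have "?f ` ?C = UNIV"
  proof (intro equalityI subsetI)
    fix x :: 'a
    \<comment> \<open>With radius (1/2)^(n+1) the errors at n and n + 1 add up to less than (1/2)^n,
      as membership in \<open>?C\<close> demands.\<close>
    have "\<exists>k. d k \<in> ball x ((1/2) ^ Suc n)" for n
      by (intro d) (simp_all add: not_le)
    then obtain \<alpha> where \<alpha>: "\<And>n. dist x (d (\<alpha> n)) < (1/2) ^ Suc n"
      unfolding mem_ball by metis
    have "dist (d (\<alpha> n)) (d (\<alpha> (Suc n))) \<le> (1/2) ^ n" for n
    proof -
      have "0 < (1/2 :: real) ^ n" by simp
      then show ?thesis
        using \<alpha>[of n] \<alpha>[of "Suc n"] dist_triangle3[of "d (\<alpha> n)" "d (\<alpha> (Suc n))" x]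
        unfolding power_Suc by linarith
    qed
    then have "\<alpha> \<in> ?C" by auto
    moreover have "(\<lambda>n. d (\<alpha> n)) \<longlonglongrightarrow> x"
    proof (rule metric_LIMSEQ_I)
      fix e :: real assume "0 < e"
      then obtain N where N: "2 * (1/2) ^ N < e"
        using LIMSEQ_D[OF lim0, of e] by auto
      have "dist (d (\<alpha> n)) x < e" if "N \<le> n" for n
      proof -
        have "0 < (1/2 :: real) ^ N" "(1/2 :: real) ^ n \<le> (1/2) ^ N"
          using power_decreasing[OF that, of "1/2::real"] by auto
        then show ?thesis
          using \<alpha>[of n] N unfolding power_Suc dist_commute[of _ x] by linarith
      qed
      then show "\<exists>N. \<forall>n\<ge>N. dist (d (\<alpha> n)) x < e" by blast
    qed
    ultimately show "x \<in> ?f ` ?C"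
      by (intro image_eqI[of _ _ \<alpha>]) (auto intro: limI[symmetric])
  qed simp
  ultimately show ?thesis
    using \<open>closed ?C\<close> by (intro analyticI)
qed

lemma analytic_Int_closed:
  assumes "analytic A" "closed F"
  shows "analytic (A \<inter> F)"
proof -
  from assms(1) obtain C :: "(nat \<Rightarrow> nat) set" and f
    where f: "closed C" "continuous_on C f" "f ` C = A" by (rule analyticE)
  show ?thesis
    using f by (intro analyticI[of "C \<inter> f -` F" f] continuous_closed_preimage assms(2)
        continuous_on_subset[OF f(2)]) auto
qed

text \<open>The sets that are analytic together with their complements form a sigma-algebra, and
  open sets belong to it because they are countable unions of closed sets.\<close>

lemma analytic_borel:
  fixes B :: "'a::{complete_space,second_countable_topology} set"
  assumes "B \<in> sets borel"
  shows "analytic B"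
proof -
  let ?S = "{B :: 'a set. analytic B \<and> analytic (- B)}"
  have empty: "analytic ({} :: 'a set)"
    using analytic_Int_closed[OF analytic_UNIV, of "{}"] by simp
  have closed: "analytic F" if "closed F" for F :: "'a set"
    using analytic_Int_closed[OF analytic_UNIV that] by simp
  have "open U \<Longrightarrow> U \<in> ?S" for U :: "'a set"
  proof -
    assume U: "open U"
    then have "fsigma_in euclidean U"
      by (intro open_imp_fsigma_in metrizable_space_euclidean) simp
    then obtain F :: "nat \<Rightarrow> 'a set" where "\<And>n. closed (F n)" "(\<Union>n. F n) = U"
      by (auto simp: fsigma_in_ascending)
    then have "analytic U"
      using analytic_UN[of F] closed by auto
    then show "U \<in> ?S"
      using closed[of "- U"] U by auto
  qed
  moreover have "sigma_algebra UNIV ?S"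
  proof (rule sigma_algebra_iff2[THEN iffD2], intro conjI ballI allI impI)
    fix A :: "nat \<Rightarrow> 'a set" assume "range A \<subseteq> ?S"
    then have "analytic (A n)" "analytic (- A n)" for n
      by auto
    then show "\<Union> (range A) \<in> ?S"
      using analytic_UN[of A] analytic_INT[of "\<lambda>n. - A n"] by (simp add: Compl_UN)
  qed (use empty analytic_UNIV in \<open>auto simp flip: Compl_eq_Diff_UNIV\<close>)
  ultimately have "sigma_sets UNIV {U :: 'a set. open U} \<subseteq> ?S"
    by (intro sigma_algebra.sigma_sets_subset) auto
  then show ?thesis
    using assms by (auto simp: sets_borel)
qed


section \<open>Separation by Borel sets\<close>

definition cylinder :: "nat list \<Rightarrow> (nat \<Rightarrow> nat) set" where
  "cylinder s = {\<alpha>. map \<alpha> [0..<length s] = s}"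

lemma cylinder_Nil [simp]: "cylinder [] = UNIV"
  by (simp add: cylinder_def)

lemma closed_cylinder: "closed (cylinder s)"
proof -
  have "map \<alpha> [0..<length s] = s \<longleftrightarrow> (\<forall>i. i < length s \<longrightarrow> \<alpha> i = s ! i)" for \<alpha>
    using map_eq_conv[of \<alpha> "[0..<length s]" "(!) s"] by (auto simp: map_nth)
  then have "cylinder s = {\<alpha>. \<forall>i. i < length s \<longrightarrow> \<alpha> i = s ! i}"
    by (simp add: cylinder_def)
  moreover have "closed {\<alpha> :: nat \<Rightarrow> nat. \<alpha> i = s ! i}" for i
    by (rule closed_Collect_eq[OF continuous_on_product_coordinates continuous_on_const])
  ultimately show ?thesis
    by (simp add: closed_Collect_all closed_Collect_imp)
qed

lemma mem_cylinder_map: "\<beta> \<in> cylinder (map \<alpha> [0..<n]) \<longleftrightarrow> (\<forall>i<n. \<beta> i = \<alpha> i)"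
  by (auto simp: cylinder_def)

lemma cylinder_append: "cylinder (s @ t) \<subseteq> cylinder s"
proof
  fix \<alpha> assume "\<alpha> \<in> cylinder (s @ t)"
  then have "take (length s) (map \<alpha> [0..<length (s @ t)]) = s"
    by (simp add: cylinder_def)
  then show "\<alpha> \<in> cylinder s"
    by (simp add: cylinder_def take_map)
qed

lemma cylinder_UN: "cylinder s = (\<Union>i. cylinder (s @ [i]))"
  using cylinder_append by (fastforce simp: cylinder_def)

lemma open_contains_cylinder:
  assumes "open U" "\<alpha> \<in> U"
  obtains n where "\<And>m. n \<le> m \<Longrightarrow> cylinder (map \<alpha> [0..<m]) \<subseteq> U"
proof -
  have "openin (product_topology (\<lambda>i. euclidean) UNIV) U"
    using assms(1) unfolding euclidean_product_topology by simp
  from product_topology_open_contains_basis[OF this assms(2)]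
  have ex: "\<exists>X. \<alpha> \<in> PiE UNIV X \<and> (\<forall>i. openin (euclidean :: nat topology) (X i)) \<and>
      finite {i. X i \<noteq> topspace euclidean} \<and> PiE UNIV X \<subseteq> U" .
  from ex obtain X where X: "\<alpha> \<in> PiE UNIV X" "finite {i. X i \<noteq> UNIV}" "PiE UNIV X \<subseteq> U"
    unfolding topspace_euclidean by metis
  from X(2) obtain n where "\<forall>i\<in>{i. X i \<noteq> UNIV}. i < n"
    unfolding finite_nat_set_iff_bounded by (rule exE)
  then have n: "\<And>i. X i \<noteq> UNIV \<Longrightarrow> i < n"
    by simp
  show ?thesis
  proof (rule that)
    fix m assume "n \<le> m"
    show "cylinder (map \<alpha> [0..<m]) \<subseteq> U"
    proof
      fix \<beta> assume "\<beta> \<in> cylinder (map \<alpha> [0..<m])"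
      then have *: "\<beta> i = \<alpha> i" if "i < m" for i
        using that by (simp add: mem_cylinder_map)
      have "\<beta> i \<in> X i" for i
        using n[of i] *[of i] X(1) \<open>n \<le> m\<close> by (cases "X i = UNIV") (auto simp: PiE_iff)
      then show "\<beta> \<in> U"
        using X(3) by auto
    qed
  qed
qed

lemma continuous_on_cylinder:
  assumes "continuous_on C f" "\<alpha> \<in> C" "open U" "f \<alpha> \<in> U"
  obtains n where "\<And>m. n \<le> m \<Longrightarrow> f ` (C \<inter> cylinder (map \<alpha> [0..<m])) \<subseteq> U"
proof -
  obtain V where V: "open V" "\<alpha> \<in> V" "\<forall>\<beta>\<in>C. \<beta> \<in> V \<longrightarrow> f \<beta> \<in> U"
    using assms unfolding continuous_on_topological by metis
  obtain n where "\<And>m. n \<le> m \<Longrightarrow> cylinder (map \<alpha> [0..<m]) \<subseteq> V"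
    using open_contains_cylinder[OF V(1,2)] by blast
  then show ?thesis
    using V(3) by (intro that[of n]) blast
qed

lemma closed_cylinder_limit:
  assumes "closed C" "\<And>n. C \<inter> cylinder (map \<alpha> [0..<n]) \<noteq> {}"
  shows "\<alpha> \<in> C"
proof (rule ccontr)
  assume "\<alpha> \<notin> C"
  then obtain n where "\<And>m. n \<le> m \<Longrightarrow> cylinder (map \<alpha> [0..<m]) \<subseteq> - C"
    using open_contains_cylinder[of "- C" \<alpha>] assms(1) by auto
  then show False
    using assms(2)[of n] by blast
qed

lemma list_chain_limit:
  fixes s :: "nat \<Rightarrow> nat list"
  assumes ext: "\<And>n. \<exists>t. s (Suc n) = s n @ t" and len: "\<And>n. n \<le> length (s n)"
  obtains \<alpha> where "\<And>n. map \<alpha> [0..<length (s n)] = s n"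
proof
  have mono: "\<exists>t. s (n + k) = s n @ t" for n k
  proof (induction k)
    case (Suc k)
    then show ?case using ext[of "n + k"] by force
  qed simp
  \<comment> \<open>Digit i is read off at stage \<open>Suc i\<close>, the first stage guaranteed to
    be longer than i.\<close>
  show "map (\<lambda>i. s (Suc i) ! i) [0..<length (s n)] = s n" for n
  proof (rule nth_equalityI; simp)
    fix i assume i: "i < length (s n)"
    show "s (Suc i) ! i = s n ! i"
      using mono[of n "Suc i - n"] mono[of "Suc i" "n - Suc i"] len[of "Suc i"] i
      by (cases "n \<le> Suc i") (auto simp: nth_append)
  qed
qed

section \<open>Lusin separation and Borel extension of analytic partial functions\<close>

definition borel_separated :: "'a::topological_space set \<Rightarrow> 'a set \<Rightarrow> bool" where
  "borel_separated A B \<longleftrightarrow> (\<exists>D\<in>sets borel. A \<subseteq> D \<and> D \<inter> B = {})"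

text \<open>Used contrapositively: if two countable unions cannot be separated, some pair of their
  pieces cannot. This drives the descent in the separation theorem.\<close>

lemma borel_separated_UN:
  assumes "\<And>(i::nat) (j::nat). borel_separated (A i) (B j)"
  shows "borel_separated (\<Union>i. A i) (\<Union>j. B j)"
proof -
  obtain D where D: "\<And>i j. D i j \<in> sets borel" "\<And>i j. A i \<subseteq> D i j" "\<And>i j. D i j \<inter> B j = {}"
    using assms unfolding borel_separated_def by metis
  have "(\<Union>i. \<Inter>j. D i j) \<in> sets borel"
    using D(1) by (intro sets.countable_UN sets.countable_INT) auto
  moreover have "(\<Union>i. A i) \<subseteq> (\<Union>i. \<Inter>j. D i j)"
    using D(2) by (intro UN_mono INT_greatest) auto
  moreover have "(\<Union>i. \<Inter>j. D i j) \<inter> (\<Union>j. B j) = {}"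
    using D(3) by (simp add: disjoint_iff) metis
  ultimately show ?thesis
    unfolding borel_separated_def by blast
qed

text \<open>Inseparability descends to ever longer pairs of cylinders, hence along two branches
  \<alpha> and \<beta>. Their images are distinct points, and disjoint neighbourhoods of these
  separate the pieces of a late stage.\<close>

theorem Lusin_separation:
  fixes A B :: "'a::t2_space set"
  assumes "analytic A" "analytic B" "A \<inter> B = {}"
  shows "borel_separated A B"
proof (rule ccontr)
  assume nsep: "\<not> borel_separated A B"
  from assms(1) obtain C :: "(nat \<Rightarrow> nat) set" and f
    where f: "closed C" "continuous_on C f" "f ` C = A" by (rule analyticE)
  from assms(2) obtain D :: "(nat \<Rightarrow> nat) set" and g
    where g: "closed D" "continuous_on D g" "g ` D = B" by (rule analyticE)
  define bad where "bad = (\<lambda>(s, t). \<not> borel_separated (f ` (C \<inter> cylinder s)) (g ` (D \<inter> cylinder t)))"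
  have step: "\<exists>i j. bad (s @ [i], t @ [j])" if "bad (s, t)" for s t
  proof (rule ccontr)
    assume "\<not> ?thesis"
    then have *: "borel_separated (f ` (C \<inter> cylinder (s @ [i]))) (g ` (D \<inter> cylinder (t @ [j])))" for i j
      by (auto simp: bad_def)
    have "borel_separated (\<Union>i. f ` (C \<inter> cylinder (s @ [i]))) (\<Union>j. g ` (D \<inter> cylinder (t @ [j])))"
      by (rule borel_separated_UN) (rule *)
    then have "borel_separated (f ` (C \<inter> cylinder s)) (g ` (D \<inter> cylinder t))"
      by (subst cylinder_UN[of s], subst cylinder_UN[of t]) (simp only: Int_UN_distrib image_UN)
    with that show False by (simp add: bad_def)
  qed
  have "\<exists>p. \<forall>n. (length (fst (p n)) = n \<and> length (snd (p n)) = n \<and> bad (p n)) \<and>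
      (\<exists>i j. p (Suc n) = (fst (p n) @ [i], snd (p n) @ [j]))"
  proof (rule dependent_nat_choice)
    show "\<exists>p. length (fst p) = 0 \<and> length (snd p) = 0 \<and> bad p"
      using nsep by (simp add: bad_def f g)
    fix p n assume "length (fst p) = n \<and> length (snd p) = n \<and> bad p"
    then show "\<exists>q. (length (fst q) = Suc n \<and> length (snd q) = Suc n \<and> bad q) \<and>
        (\<exists>i j. q = (fst p @ [i], snd p @ [j]))"
      using step[of "fst p" "snd p"] by force
  qed
  then obtain p where p: "\<And>n. length (fst (p n)) = n" "\<And>n. length (snd (p n)) = n" "\<And>n. bad (p n)"
      "\<And>n. \<exists>i j. p (Suc n) = (fst (p n) @ [i], snd (p n) @ [j])"
    by blast
  have "\<exists>t. fst (p (Suc n)) = fst (p n) @ t" "\<exists>t. snd (p (Suc n)) = snd (p n) @ t" for n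
    using p(4)[of n] by auto
  then obtain \<alpha> \<beta> where \<alpha>: "\<And>n. map \<alpha> [0..<n] = fst (p n)" and \<beta>: "\<And>n. map \<beta> [0..<n] = snd (p n)"
    using list_chain_limit[of "\<lambda>n. fst (p n)"] list_chain_limit[of "\<lambda>n. snd (p n)"] p(1,2)
    by (metis order_refl)
  have bad: "\<not> borel_separated (f ` (C \<inter> cylinder (map \<alpha> [0..<n]))) (g ` (D \<inter> cylinder (map \<beta> [0..<n])))" for n
    using p(3)[of n] by (simp add: \<alpha> \<beta> bad_def case_prod_unfold)
  have "\<alpha> \<in> C"
  proof (rule closed_cylinder_limit[OF f(1)])
    \<comment> \<open>An empty piece would be separated trivially, so the surviving cylinders all
      meet \<open>C\<close>.\<close>
    show "C \<inter> cylinder (map \<alpha> [0..<n]) \<noteq> {}" for n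
      using bad[of n] unfolding borel_separated_def by (metis image_empty empty_subsetI Int_empty_left sets.empty_sets)
  qed
  have "\<beta> \<in> D"
  proof (rule closed_cylinder_limit[OF g(1)])
    show "D \<inter> cylinder (map \<beta> [0..<n]) \<noteq> {}" for n
      using bad[of n] unfolding borel_separated_def
      by (metis image_empty Int_empty_right borel_open open_UNIV subset_UNIV)
  qed
  have "f \<alpha> \<noteq> g \<beta>"
    using \<open>\<alpha> \<in> C\<close> \<open>\<beta> \<in> D\<close> f(3) g(3) assms(3) by blast
  then obtain U V where UV: "open U" "open V" "f \<alpha> \<in> U" "g \<beta> \<in> V" "U \<inter> V = {}"
    by (metis hausdorff)
  obtain m where m: "\<And>k. m \<le> k \<Longrightarrow> f ` (C \<inter> cylinder (map \<alpha> [0..<k])) \<subseteq> U"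
    using continuous_on_cylinder[OF f(2) \<open>\<alpha> \<in> C\<close> UV(1,3)] by blast
  obtain n where n: "\<And>k. n \<le> k \<Longrightarrow> g ` (D \<inter> cylinder (map \<beta> [0..<k])) \<subseteq> V"
    using continuous_on_cylinder[OF g(2) \<open>\<beta> \<in> D\<close> UV(2,4)] by blast
  have "borel_separated (f ` (C \<inter> cylinder (map \<alpha> [0..<max m n])))
      (g ` (D \<inter> cylinder (map \<beta> [0..<max m n])))"
    unfolding borel_separated_def
    using m[of "max m n"] n[of "max m n"] UV by (intro bexI[of _ U]) auto
  with bad show False by blast
qed

text \<open>For each coordinate and each threshold q, the arguments with value below q and those
  with value at least q form disjoint analytic sets, so a Borel set separates them. The function is
  rebuilt from these Borel sets on the whole space.\<close>

lemma analytic_graph_extension: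
  fixes A :: "('a::{complete_space,second_countable_topology} \<times> (nat \<Rightarrow> real)) set"
  assumes A: "analytic A" and sv: "single_valued A"
  obtains h where "h \<in> borel_measurable borel" "\<And>x y. (x, y) \<in> A \<Longrightarrow> y = h x"
proof -
  have proj: "analytic (fst ` (A \<inter> B))" if "B \<in> sets borel" for B
    by (rule analytic_image[OF analytic_Int[OF A analytic_borel[OF that]] continuous_on_fst[OF continuous_on_id]])
  have "\<exists>D\<in>sets borel. fst ` (A \<inter> {p. snd p n < q}) \<subseteq> D \<and> D \<inter> fst ` (A \<inter> {p. q \<le> snd p n}) = {}"
    for n and q :: real
  proof -
    have c: "continuous_on UNIV (\<lambda>p :: 'a \<times> (nat \<Rightarrow> real). snd p n)"
      by (rule continuous_on_compose2[OF continuous_on_product_coordinates[of n]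
            continuous_on_snd[OF continuous_on_id]]) simp
    have "fst ` (A \<inter> {p. snd p n < q}) \<inter> fst ` (A \<inter> {p. q \<le> snd p n}) = {}"
      using single_valuedD[OF sv] by (auto simp: disjoint_iff not_le) (metis not_le)
    moreover have "open {p :: 'a \<times> (nat \<Rightarrow> real). snd p n < q}"
      by (rule open_Collect_less[OF c continuous_on_const])
    moreover have "closed {p :: 'a \<times> (nat \<Rightarrow> real). q \<le> snd p n}"
      by (rule closed_Collect_le[OF continuous_on_const c])
    ultimately show ?thesis
      unfolding borel_separated_def[symmetric]
      by (intro Lusin_separation proj borel_open borel_closed)
  qed
  then obtain D where D: "\<And>n q. D n q \<in> sets borel"
      "\<And>n q. fst ` (A \<inter> {p. snd p n < q}) \<subseteq> D n q"
      "\<And>n q. D n q \<inter> fst ` (A \<inter> {p. q \<le> snd p n}) = {}"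
    by metis
  \<comment> \<open>The \<open>n\<close>-th coordinate of \<open>y\<close> is the supremum of the rationals \<open>q \<le> y n\<close>.\<close>
  define H where "H = (\<lambda>n x. SUP q\<in>\<rat>. if x \<in> D n q then - \<infinity> else ereal q)"
  \<comment> \<open>Off the domain of \<open>A\<close> the supremum may be infinite;
    \<open>real_of_ereal\<close> then supplies the value 0.\<close>
  define h where "h = (\<lambda>x n. real_of_ereal (H n x))"
  have [measurable]: "Measurable.pred borel (\<lambda>x. x \<in> D n q)" for n q
    using D(1)[of n q] by simp
  have "H n \<in> borel_measurable borel" for n
    unfolding H_def using countable_rat by measurable
  then have "h \<in> borel_measurable borel"
    unfolding h_def by (intro measurable_coordinatewise_then_product) simp
  moreover have "y = h x" if xy: "(x, y) \<in> A" for x y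
  proof
    fix n
    have D': "x \<in> D n q \<longleftrightarrow> y n < q" for q
      using D(2,3)[of n q] xy by (force simp: not_less)
    have "H n x = ereal (y n)"
      unfolding H_def
    proof (rule SUP_eqI)
      show "(if x \<in> D n q then - \<infinity> else ereal q) \<le> ereal (y n)" for q
        by (simp add: D')
      fix z assume z: "\<And>q. q \<in> \<rat> \<Longrightarrow> (if x \<in> D n q then - \<infinity> else ereal q) \<le> z"
      show "ereal (y n) \<le> z"
      proof (rule ereal_le_epsilon2)
        fix e :: real assume "0 < e"
        then obtain q where "q \<in> \<rat>" "y n - e < q" "q < y n"
          using Rats_dense_in_real[of "y n - e" "y n"] by auto
        then have "ereal q \<le> z"
          using z[of q] by (simp add: D')
        then show "ereal (y n) \<le> z + ereal e"
          using \<open>y n - e < q\<close> by (cases z) auto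
      qed
    qed
    then show "y n = h x n" by (simp add: h_def)
  qed
  ultimately show ?thesis using that by blast
qed


section \<open>The Lusin--Novikov theorem\<close>

definition graphs :: "(nat \<Rightarrow> 'a \<Rightarrow> 'b) \<Rightarrow> ('a \<times> 'b) set" where
  "graphs h = {(x, y). \<exists>i. y = h i x}"

lemma graphs_borel:
  fixes h :: "nat \<Rightarrow> 'a::{complete_space,second_countable_topology} \<Rightarrow> 'b::{complete_space,second_countable_topology}"
  assumes [measurable]: "\<And>i. h i \<in> borel_measurable borel"
  shows "graphs h \<in> sets borel"
proof -
  have "{p \<in> space (borel \<Otimes>\<^sub>M borel). \<exists>i. snd p = h i (fst p)} \<in> sets (borel \<Otimes>\<^sub>M borel)"
    by measurable
  moreover have "{p \<in> space (borel \<Otimes>\<^sub>M borel). \<exists>i. snd p = h i (fst p)} = graphs h"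
    by (auto simp: graphs_def space_pair_measure)
  ultimately show ?thesis
    by (metis borel_prod)
qed

lemma analytic_INT_list:
  fixes Q :: "'s \<Rightarrow> 'a::{complete_space,second_countable_topology} set"
  assumes "\<And>s. s \<in> set a \<Longrightarrow> analytic (Q s)"
  shows "analytic (\<Inter>s\<in>set a. Q s)"
proof -
  have "analytic (\<Inter>n. if n < length a then Q (a ! n) else UNIV)"
    using assms by (intro analytic_INT) (simp add: analytic_UNIV)
  moreover have "(\<Inter>n. if n < length a then Q (a ! n) else UNIV) = (\<Inter>s\<in>set a. Q s)"
    by (auto simp: in_set_conv_nth split: if_splits) (metis nth_mem)
  ultimately show ?thesis by metis
qed

theorem Lusin_Novikov:
  fixes P :: "('a::{complete_space,second_countable_topology} \<times> (nat \<Rightarrow> real)) set"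
  assumes P: "P \<in> sets borel" and count: "\<And>x. countable (P `` {x})"
  obtains h where "\<And>i :: nat. h i \<in> borel_measurable borel" "P \<subseteq> graphs h"
proof -
  obtain C :: "(nat \<Rightarrow> nat) set" and f
    where f: "closed C" "continuous_on C f" "f ` C = P"
    using analytic_borel[OF P] by (rule analyticE)
  define Q where "Q = (\<lambda>s. f ` (C \<inter> cylinder s))"
  define BF where "BF = {h :: nat \<Rightarrow> 'a \<Rightarrow> nat \<Rightarrow> real. \<forall>i. h i \<in> borel_measurable borel}"
  define large where "large = (\<lambda>a. \<forall>h\<in>BF. \<exists>x. \<forall>s\<in>set a. \<exists>y. (x, y) \<in> Q s - graphs h)"
  \<comment> \<open>A finite list of cylinders is large if no countable family of Borel functions prevents the
    pieces \<open>Q s\<close> from having points over a common \<open>x\<close>. Otherwise the theorem holds for the trivial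
    list; a large list can be refined so that one of its cylinders splits, which leads to a fibre
    containing the image of a nonempty closed set on which \<open>snd \<circ> f\<close> is nowhere locally constant.\<close>
  define ext where "ext = (\<lambda>m i a b.
      length b = Suc (length a) \<and> (\<forall>j<length a. \<exists>t. b ! j = a ! j @ t) \<and>
      (\<exists>t. b ! length a = a ! i @ t) \<and> (\<forall>j\<le>length a. m \<le> length (b ! j)) \<and>
      snd ` Q (b ! i) \<inter> snd ` Q (b ! length a) = {})"

  have Q: "analytic (Q s)" for s
    unfolding Q_def
    by (rule analyticI[OF closed_Int[OF f(1) closed_cylinder] continuous_on_subset[OF f(2)]]) auto

  \<comment> \<open>If every such refinement were ruled out by some family, these families together
    would confine the relevant part of \<open>Q (a ! i)\<close> to one point per fibre, and one more
    Borel function would rule out \<open>a\<close> itself.\<close>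
  have split: "\<exists>b. large b \<and> ext m i a b" if a: "large a" and i: "i < length a" for m i a
  proof (rule ccontr)
    assume "\<not> ?thesis"
    then have "\<forall>b. \<exists>h. ext m i a b \<longrightarrow> h \<in> BF \<and> (\<forall>x. \<exists>s\<in>set b. \<forall>y. (x, y) \<notin> Q s - graphs h)"
      unfolding large_def by metis
    then obtain H where H: "\<And>b. ext m i a b \<Longrightarrow> H b \<in> BF"
        "\<And>b x. ext m i a b \<Longrightarrow> \<exists>s\<in>set b. \<forall>y. (x, y) \<notin> Q s - graphs (H b)"
      by metis
    \<comment> \<open>There are only countably many lists \<open>b\<close>, so the families
      \<open>H b\<close> merge into one sequence; the constant function fills the indices of lists
      that are not refinements.\<close>
    define G where "G = (\<lambda>n. case prod_decode n of (k, l) \<Rightarrow>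
        if ext m i a (from_nat k) then H (from_nat k) l else (\<lambda>_. undefined))"
    have G: "G \<in> BF"
      using H(1) by (auto simp: G_def BF_def split: prod.split)
    have "y = G (prod_encode (to_nat b, l)) x" if "ext m i a b" "y = H b l x" for b l x y
      using that by (simp add: G_def)
    then have HG: "graphs (H b) \<subseteq> graphs G" if "ext m i a b" for b
      using that unfolding graphs_def by blast
    \<comment> \<open>These are the points of the piece to be split that escape \<open>G\<close> and
      lie over some x above which every piece has a point escaping \<open>G\<close>. Two of them
      over the same x would yield a refinement that its own family \<open>H b\<close> fails to rule
      out.\<close>
    define A where "A = (Q (a ! i) - graphs G) \<inter>
        (\<Inter>s\<in>set a. fst ` (Q s - graphs G) \<times> UNIV)"
    have gb: "- graphs G \<in> sets borel"
      using graphs_borel[of G] G by (auto simp: BF_def)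
    have dif: "analytic (Q s - graphs G)" for s
      using analytic_Int[OF Q analytic_borel[OF gb], of s] by (simp add: Diff_eq)
    have sec: "analytic (fst ` (Q s - graphs G) \<times> (UNIV :: (nat \<Rightarrow> real) set))" for s
      by (rule analytic_Times[OF analytic_image[OF dif continuous_on_fst[OF continuous_on_id]] analytic_UNIV])
    have "analytic A"
      unfolding A_def by (intro analytic_Int dif analytic_INT_list sec)
    moreover have "single_valued A"
    proof (rule single_valuedI, rule ccontr)
      fix x y y' assume A: "(x, y) \<in> A" "(x, y') \<in> A" and "y \<noteq> y'"
      obtain U V where UV: "open U" "open V" "y \<in> U" "y' \<in> V" "U \<inter> V = {}"
        using \<open>y \<noteq> y'\<close> by (metis hausdorff)
      have "\<forall>j. \<exists>\<alpha>. j < length a \<longrightarrow> \<alpha> \<in> C \<inter> cylinder (a ! j) \<and> fst (f \<alpha>) = x \<and> f \<alpha> \<notin> graphs G"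
      proof (intro allI)
        fix j
        have "x \<in> fst ` (Q (a ! j) - graphs G)" if "j < length a"
          using A(1) that by (auto simp: A_def)
        then show "\<exists>\<alpha>. j < length a \<longrightarrow> \<alpha> \<in> C \<inter> cylinder (a ! j) \<and> fst (f \<alpha>) = x \<and> f \<alpha> \<notin> graphs G"
          unfolding Q_def by fastforce
      qed
      then obtain c where c: "\<And>j. j < length a \<Longrightarrow> c j \<in> C \<inter> cylinder (a ! j)"
          "\<And>j. j < length a \<Longrightarrow> fst (f (c j)) = x" "\<And>j. j < length a \<Longrightarrow> f (c j) \<notin> graphs G"
        by metis
      obtain u where u: "u \<in> C" "u \<in> cylinder (a ! i)" "f u = (x, y)" "f u \<notin> graphs G"
        using A(1) by (auto simp: A_def Q_def)
      obtain v where v: "v \<in> C" "v \<in> cylinder (a ! i)" "f v = (x, y')" "f v \<notin> graphs G"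
        using A(2) by (auto simp: A_def Q_def)
      \<comment> \<open>The code u of (x, y) continues piece i, and the code v of (x, y') opens the
        new last piece; both start with \<open>a ! i\<close>.\<close>
      define d where "d = c(i := u, length a := v)"
      have d: "d j \<in> C" "fst (f (d j)) = x" "f (d j) \<notin> graphs G" if "j \<le> length a" for j
        using that c[of j] u v i by (auto simp: d_def)
      have d': "d j \<in> cylinder (a ! j)" if "j < length a" for j
        using that c[of j] u by (auto simp: d_def)
      have sf: "continuous_on C (\<lambda>\<alpha>. snd (f \<alpha>))"
        by (rule continuous_on_snd[OF f(2)])
      obtain m1 where m1: "\<And>k. m1 \<le> k \<Longrightarrow> (\<lambda>\<alpha>. snd (f \<alpha>)) ` (C \<inter> cylinder (map u [0..<k])) \<subseteq> U"
        using continuous_on_cylinder[OF sf u(1) UV(1)] u(3) UV(3) by auto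
      obtain m2 where m2: "\<And>k. m2 \<le> k \<Longrightarrow> (\<lambda>\<alpha>. snd (f \<alpha>)) ` (C \<inter> cylinder (map v [0..<k])) \<subseteq> V"
        using continuous_on_cylinder[OF sf v(1) UV(2)] v(3) UV(4) by auto
      \<comment> \<open>One truncation length for all codes: at least m as \<open>ext\<close> asks,
        past m1 and m2 to keep the two halves apart, and no shorter than any entry of
        \<open>a\<close>.\<close>
      define N where "N = m + m1 + m2 + sum_list (map length a)"
      have len: "length (a ! j) \<le> N" if "j < length a" for j
        using member_le_sum_list[of "length (a ! j)" "map length a"] that by (auto simp: N_def)
      have pre: "\<exists>t. map \<alpha> [0..<N] = s @ t" if "\<alpha> \<in> cylinder s" "length s \<le> N" for \<alpha> s
      proof
        show "map \<alpha> [0..<N] = s @ map \<alpha> [length s..<N]"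
          using that upt_add_eq_append[of 0 "length s" "N - length s"]
          by (simp add: cylinder_def)
      qed
      define b where "b = map (\<lambda>j. map (d j) [0..<N]) [0..<Suc (length a)]"
      have nth: "b ! j = map (d j) [0..<N]" if "j \<le> length a" for j
        using that unfolding b_def by (subst nth_map) (auto simp del: upt_Suc)
      have "snd ` Q (map u [0..<N]) \<subseteq> U" "snd ` Q (map v [0..<N]) \<subseteq> V"
        using m1[of N] m2[of N] by (auto simp: Q_def N_def image_image)
      then have "snd ` Q (b ! i) \<inter> snd ` Q (b ! length a) = {}"
        using i UV(5) by (auto simp: nth d_def)
      moreover have "\<exists>t. b ! length a = a ! i @ t"
        using pre[OF v(2) len[OF i]] by (simp add: nth d_def)
      moreover have "\<exists>t. b ! j = a ! j @ t" if "j < length a" for j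
        using pre[OF d'[OF that] len[OF that]] that by (simp add: nth)
      ultimately have "ext m i a b"
        unfolding ext_def by (auto simp: nth N_def) (simp add: b_def)
      moreover have "\<exists>y. (x, y) \<in> Q s - graphs G" if "s \<in> set b" for s
      proof -
        from \<open>s \<in> set b\<close> obtain j where "j \<in> set [0..<Suc (length a)]" "s = map (d j) [0..<N]"
          unfolding b_def set_map by (rule imageE)
        then have j: "j \<le> length a" "s = map (d j) [0..<N]"
          by (auto simp del: map_eq_conv)
        then have "f (d j) \<in> Q s - graphs G"
          using d[OF j(1)] by (auto simp: Q_def mem_cylinder_map)
        then show ?thesis
          using d(2)[OF j(1)] by (metis prod.collapse)
      qed
      ultimately show False
        using H(2)[of b x] HG[of b] by blast
    qed
    ultimately obtain h where h: "h \<in> borel_measurable borel" "\<And>x y. (x, y) \<in> A \<Longrightarrow> y = h x"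
      using analytic_graph_extension[of A] by metis
    \<comment> \<open>Largeness of \<open>a\<close> is applied to \<open>G\<close> with
      \<open>h\<close> put in front: the surviving point of \<open>Q (a ! i)\<close> lies in
      \<open>A\<close> and yet off the graph of \<open>h\<close>.\<close>
    have "case_nat h G \<in> BF"
      using h(1) G by (auto simp: BF_def split: nat.split)
    then obtain x where x: "\<And>s. s \<in> set a \<Longrightarrow> \<exists>y. (x, y) \<in> Q s - graphs (case_nat h G)"
      using a unfolding large_def by blast
    have "(\<exists>i. R i) \<longleftrightarrow> R 0 \<or> (\<exists>i. R (Suc i))" for R :: "nat \<Rightarrow> bool"
      by (metis nat.exhaust)
    note this[of "\<lambda>i. y = case_nat h G i x" for x y]
    then have GG: "graphs (case_nat h G) = {(x, y). y = h x} \<union> graphs G"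
      by (auto simp: graphs_def)
    from x[of "a ! i"] i obtain y where y: "(x, y) \<in> Q (a ! i)" "(x, y) \<notin> graphs G" "y \<noteq> h x"
      unfolding GG by auto
    have "(x, y) \<in> A"
      using y(1,2) x unfolding GG A_def by force
    with h(2) y(3) show False by blast
  qed

  have "\<not> large [[]]"
  proof
    assume "large [[]]"
    \<comment> \<open>Decoding pairs makes every index recur at arbitrarily late stages, so each
      branch is split again and again; \<open>idx n \<le> n\<close> keeps the index within the list
      of length \<open>Suc n\<close>.\<close>
    define idx where "idx = (\<lambda>n. fst (prod_decode n))"
    have idx: "idx n \<le> n" for n
      unfolding idx_def by (metis le_prod_encode_1 prod.collapse prod_decode_inverse)
    have "\<exists>a. \<forall>n. (length (a n) = Suc n \<and> large (a n)) \<and> ext (Suc n) (idx n) (a n) (a (Suc n))"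
    proof (rule dependent_nat_choice)
      show "\<exists>a. length a = Suc 0 \<and> large a"
        using \<open>large [[]]\<close> by (intro exI[of _ "[[]]"]) simp
      fix a n assume "length a = Suc n \<and> large (a :: nat list list)"
      then show "\<exists>b. (length b = Suc (Suc n) \<and> large b) \<and> ext (Suc n) (idx n) a b"
        using split[of a "idx n" "Suc n"] idx[of n] by (auto simp: ext_def less_Suc_eq_le)
    qed
    then obtain a where a: "\<And>n. length (a n) = Suc n" "\<And>n. large (a n)"
        "\<And>n. ext (Suc n) (idx n) (a n) (a (Suc n))"
      by blast
    have len: "n \<le> length (a n ! j)" if "j \<le> n" for j n
      using that a(1)[of "n - 1"] a(3)[of "n - 1"] by (cases n) (auto simp: ext_def)
    have grow: "\<exists>t. a (Suc n) ! j = a n ! j @ t" if "j \<le> n" for j n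
      using that a(1)[of n] a(3)[of n] by (auto simp: ext_def)
    \<comment> \<open>Piece j exists only from stage j on, hence the shift by j in the
      chain.\<close>
    have "\<exists>\<alpha>. \<forall>n\<ge>j. \<alpha> \<in> cylinder (a n ! j)" for j
    proof (rule list_chain_limit[of "\<lambda>n. a (n + j) ! j"])
      show "\<exists>t. a (Suc n + j) ! j = a (n + j) ! j @ t" for n
        using grow[of j "n + j"] by simp
      show "n \<le> length (a (n + j) ! j)" for n
        using len[of j "n + j"] by simp
      fix \<alpha> assume \<alpha>: "\<And>n. map \<alpha> [0..<length (a (n + j) ! j)] = a (n + j) ! j"
      have "\<alpha> \<in> cylinder (a n ! j)" if "j \<le> n" for n
        using \<alpha>[of "n - j"] that by (simp add: cylinder_def)
      then show ?thesis by blast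
    qed
    then obtain c where c: "\<And>j n. j \<le> n \<Longrightarrow> c j \<in> cylinder (a n ! j)"
      by metis
    have sub: "cylinder (a n ! j) \<subseteq> cylinder (map (c j) [0..<m])" if "j \<le> n" "m \<le> n" for j n m
    proof
      fix \<beta> assume "\<beta> \<in> cylinder (a n ! j)"
      then have "map \<beta> [0..<length (a n ! j)] = map (c j) [0..<length (a n ! j)]"
        using c[OF that(1)] by (simp add: cylinder_def)
      then show "\<beta> \<in> cylinder (map (c j) [0..<m])"
        using len[OF that(1)] that(2) by (auto simp: mem_cylinder_map)
    qed
    \<comment> \<open>Here largeness is applied to an arbitrary family: it says that all pieces of
      one stage meet a common fibre, which may still depend on the stage.\<close>
    have ex: "\<exists>x. \<forall>s\<in>set (a n). \<exists>\<alpha>\<in>C \<inter> cylinder s. fst (f \<alpha>) = x" for n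
    proof -
      have "(\<lambda>_ _. undefined) \<in> BF" by (simp add: BF_def)
      then obtain x where "\<forall>s\<in>set (a n). \<exists>y. (x, y) \<in> Q s"
        using a(2)[of n] unfolding large_def by blast
      then show ?thesis
        unfolding Q_def by (intro exI[of _ x] ballI) (metis fst_conv image_iff)
    qed
    have cC: "c j \<in> C" for j
    proof (rule closed_cylinder_limit[OF f(1)])
      fix n
      have "a (max j n) ! j \<in> set (a (max j n))"
        using a(1) by (intro nth_mem) (simp add: less_Suc_eq_le)
      then show "C \<inter> cylinder (map (c j) [0..<n]) \<noteq> {}"
        using ex[of "max j n"] sub[of j "max j n" n] by fastforce
    qed
    define x where "x = fst (f (c 0))"
    have cf: "continuous_on C (\<lambda>\<alpha>. fst (f \<alpha>))"
      by (rule continuous_on_fst[OF f(2)])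
    \<comment> \<open>The fibres of the stages agree in the limit: different first coordinates of
      two branches would be kept apart by neighbourhoods at some finite stage, where the two pieces
      still have points over a common x.\<close>
    have xc: "fst (f (c j)) = x" for j
    proof (rule ccontr)
      assume "fst (f (c j)) \<noteq> x"
      then obtain U V where UV: "open U" "open V" "fst (f (c j)) \<in> U" "fst (f (c 0)) \<in> V" "U \<inter> V = {}"
        unfolding x_def by (metis hausdorff)
      obtain m1 where m1: "\<And>k. m1 \<le> k \<Longrightarrow> (\<lambda>\<alpha>. fst (f \<alpha>)) ` (C \<inter> cylinder (map (c j) [0..<k])) \<subseteq> U"
        using continuous_on_cylinder[OF cf cC UV(1,3)] by blast
      obtain m2 where m2: "\<And>k. m2 \<le> k \<Longrightarrow> (\<lambda>\<alpha>. fst (f \<alpha>)) ` (C \<inter> cylinder (map (c 0) [0..<k])) \<subseteq> V"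
        using continuous_on_cylinder[OF cf cC UV(2,4)] by blast
      define n where "n = j + m1 + m2"
      have "a n ! j \<in> set (a n)" "a n ! 0 \<in> set (a n)"
        using a(1)[of n] by (auto simp: n_def)
      then obtain \<alpha> \<beta> where \<alpha>\<beta>: "\<alpha> \<in> C \<inter> cylinder (a n ! j)" "\<beta> \<in> C \<inter> cylinder (a n ! 0)"
          "fst (f \<alpha>) = fst (f \<beta>)"
        using ex[of n] by metis
      have "cylinder (a n ! j) \<subseteq> cylinder (map (c j) [0..<n])"
          "cylinder (a n ! 0) \<subseteq> cylinder (map (c 0) [0..<n])"
        by (rule sub; simp add: n_def)+
      then have "\<alpha> \<in> C \<inter> cylinder (map (c j) [0..<n])" "\<beta> \<in> C \<inter> cylinder (map (c 0) [0..<n])"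
        using \<alpha>\<beta> by auto
      then have "fst (f \<alpha>) \<in> U" "fst (f \<beta>) \<in> V"
        using m1[of n] m2[of n] by (auto simp: n_def image_subset_iff)
      then show False using UV(5) \<alpha>\<beta>(3) by auto
    qed
    \<comment> \<open>All branches have their images in the single fibre over x, and so does their
      closure. Countability of that fibre covers \<open>K\<close> by countably many closed sets
      \<open>F y\<close>, which sets the stage for Baire.\<close>
    define K where "K = closure (range c)"
    have KC: "K \<subseteq> C"
      unfolding K_def using cC by (intro closure_minimal f(1)) auto
    have Kx: "fst (f \<alpha>) = x" if "\<alpha> \<in> K" for \<alpha>
    proof -
      have "closed {\<alpha> \<in> C. fst (f \<alpha>) = x}"
        by (rule continuous_closed_preimage_constant[OF cf f(1)])
      then have "K \<subseteq> {\<alpha> \<in> C. fst (f \<alpha>) = x}"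
        unfolding K_def using cC xc by (intro closure_minimal) auto
      with that show ?thesis by blast
    qed
    let ?K = "top_of_set K"
    have "completely_metrizable_space (euclidean :: (nat \<Rightarrow> nat) topology)"
    proof -
      have "discrete_topology UNIV = (euclidean :: nat topology)"
        unfolding discrete_topology_unique by (simp add: open_discrete)
      then have "completely_metrizable_space (euclidean :: nat topology)"
        using completely_metrizable_space_discrete_topology[of "UNIV :: nat set"] by simp
      then show ?thesis
        unfolding euclidean_product_topology[symmetric] completely_metrizable_space_product_topology
        by simp
    qed
    then have cm: "completely_metrizable_space ?K"
      by (rule completely_metrizable_space_closedin) (simp add: K_def)
    define F where "F = (\<lambda>y. {\<alpha> \<in> K. snd (f \<alpha>) = y})"
    have "closed (F y)" for y
      unfolding F_def
      by (rule continuous_closed_preimage_constant[OF continuous_on_subset[OF continuous_on_snd[OF f(2)] KC]])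
         (simp add: K_def)
    then have Fc: "closedin ?K (F y)" for y
      by (simp add: closed_subset F_def)
    have cov: "\<Union> (F ` (P `` {x})) = K"
    proof (intro equalityI subsetI)
      fix \<alpha> assume "\<alpha> \<in> K"
      then have "f \<alpha> \<in> P" "f \<alpha> = (x, snd (f \<alpha>))"
        using KC f(3) Kx[of \<alpha>] by (auto simp: prod_eq_iff)
      then show "\<alpha> \<in> \<Union> (F ` (P `` {x}))"
        using \<open>\<alpha> \<in> K\<close> by (auto simp: F_def)
    qed (auto simp: F_def)
    have "\<exists>y. ?K interior_of (F y) \<noteq> {}"
    proof (rule ccontr)
      assume "\<not> ?thesis"
      then have "?K interior_of \<Union> (F ` (P `` {x})) = {}"
        using cm Fc count by (intro Baire_category_alt) auto
      then show False
        unfolding cov using interior_of_topspace[of ?K] closure_subset[of "range c"]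
        by (auto simp: K_def)
    qed
    then obtain y \<alpha> T where "openin ?K T" "\<alpha> \<in> T" "T \<subseteq> F y"
      by (auto simp: interior_of_def)
    then obtain W where W: "open W" "\<alpha> \<in> W" "\<alpha> \<in> K" "K \<inter> W \<subseteq> F y"
      by (auto simp: openin_open)
    then obtain j where j: "c j \<in> W"
      unfolding K_def by (metis closure_iff_nhds_not_empty disjoint_iff rangeE subset_refl)
    obtain m where "\<And>k. m \<le> k \<Longrightarrow> cylinder (map (c j) [0..<k]) \<subseteq> W"
      using open_contains_cylinder[OF W(1) j] by blast
    then have m: "cylinder (map (c j) [0..<m]) \<subseteq> W"
      by simp
    \<comment> \<open>A late stage at which branch j is split: the new branch
      \<open>c (Suc n)\<close> stays in the neighbourhood \<open>W\<close> where
      \<open>snd \<circ> f\<close> is constant on \<open>K\<close>, although the split gave the two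
      branches different values.\<close>
    define n where "n = prod_encode (j, m)"
    have n: "idx n = j" "j \<le> n" "m \<le> n"
      using le_prod_encode_1 le_prod_encode_2 by (auto simp: idx_def n_def)
    have spl: "snd ` Q (a (Suc n) ! j) \<inter> snd ` Q (a (Suc n) ! Suc n) = {}"
        "\<exists>t. a (Suc n) ! Suc n = a n ! j @ t"
      using a(3)[of n] a(1)[of n] n(1) by (auto simp: ext_def)
    have "c (Suc n) \<in> cylinder (a n ! j)"
      using c[of "Suc n" "Suc n"] spl(2) cylinder_append by force
    then have "c (Suc n) \<in> W"
      using sub[OF n(2,3)] m by blast
    then have "snd (f (c (Suc n))) = y" "snd (f (c j)) = y"
      using W(4) j closure_subset[of "range c"] by (auto simp: F_def K_def)
    moreover have "snd (f (c (Suc n))) \<in> snd ` Q (a (Suc n) ! Suc n)" "snd (f (c j)) \<in> snd ` Q (a (Suc n) ! j)"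
      using c[of "Suc n" "Suc n"] c[of j "Suc n"] n(2) cC by (auto simp: Q_def)
    ultimately show False using spl(1) by auto
  qed
  then obtain h where "h \<in> BF" "\<And>x y. (x, y) \<in> Q [] \<Longrightarrow> (x, y) \<in> graphs h"
    unfolding large_def by auto
  moreover have "Q [] = P"
    using f(3) by (simp add: Q_def)
  ultimately show ?thesis
    by (intro that[of h]) (auto simp: BF_def)
qed


section \<open>Standard Borel spaces\<close>

lemma standard_borel_metric:
  assumes "standard_borel M" "space M \<noteq> {}"
  obtains d and q :: "nat \<Rightarrow> 'a" and T where "Metric_space (space M) d" "completely_metrizable_space T"
    "T = Metric_space.mtopology (space M) d" "sets M = sigma_sets (space M) {U. openin T U}"
    "\<forall>k. q k \<in> space M" "\<forall>x\<in>space M. \<forall>r>0. \<exists>k. d x (q k) < r"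
proof -
  obtain T where T: "completely_metrizable_space T" "second_countable T" "topspace T = space M"
      "sets M = sigma_sets (space M) {U. openin T U}"
    using assms(1) unfolding standard_borel_def by blast
  obtain N d where "Metric_space N d" "T = Metric_space.mtopology N d"
    using completely_metrizable_imp_metrizable_space[OF T(1)] unfolding metrizable_space_def by blast
  then interpret Metric_space N d by simp
  have N: "N = space M"
    using T(3) \<open>T = mtopology\<close> by simp
  obtain Q where Q: "countable Q" "Q \<subseteq> space M" "T closure_of Q = space M"
    using second_countable_imp_separable_space[OF T(2)] T(3) unfolding separable_space_def by metis
  have "Q \<noteq> {}"
    using Q(3) assms(2) by auto
  have "\<exists>k. d x (from_nat_into Q k) < r" if x: "x \<in> space M" and r: "0 < r" for x r
  proof -
    have "x \<in> mtopology closure_of Q"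
      using Q(3) x \<open>T = mtopology\<close> by simp
    then obtain y where "y \<in> Q" "y \<in> mball x r"
      using r unfolding metric_closure_of by auto
    then show ?thesis
      using from_nat_into_surj[OF Q(1)] by (metis in_mball)
  qed
  moreover have "from_nat_into Q k \<in> space M" for k
    using from_nat_into[OF \<open>Q \<noteq> {}\<close>] Q(2) by blast
  ultimately show ?thesis
    using that[of d T "from_nat_into Q"] T \<open>T = mtopology\<close> \<open>Metric_space N d\<close> N by simp
qed

text \<open>The distances to a dense sequence embed the space homeomorphically into the real
  sequences. The image is Borel, so the inverse extends to a Borel map \<open>r\<close> on all
  sequences.\<close>

lemma standard_borel_retract:
  fixes M :: "'a measure"
  assumes "standard_borel M" "space M \<noteq> {}"
  obtains c :: "'a \<Rightarrow> nat \<Rightarrow> real" and r where "c \<in> borel_measurable M" "r \<in> measurable borel M"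
    "\<And>x. x \<in> space M \<Longrightarrow> r (c x) = x"
proof -
  let ?X = "space M"
  obtain d T and q :: "nat \<Rightarrow> 'a" where d: "Metric_space ?X d" and T: "completely_metrizable_space T"
    "T = Metric_space.mtopology ?X d" and sets: "sets M = sigma_sets ?X {U. openin T U}"
    and q': "\<forall>k. q k \<in> ?X" "\<forall>x\<in>?X. \<forall>r>0. \<exists>k. d x (q k) < r"
    by (rule standard_borel_metric[OF assms])
  have q: "\<And>k. q k \<in> ?X" "\<And>x r. x \<in> ?X \<Longrightarrow> 0 < r \<Longrightarrow> \<exists>k. d x (q k) < r"
    using q' by auto
  interpret Metric_space ?X d by (rule d)
  have topT: "topspace T = ?X"
    using T(2) by simp
  define c where "c = (\<lambda>x k. d x (q k))"
  have cont: "continuous_map T euclidean (\<lambda>x. c x k)" for k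
    using continuous_map_mdist[of mtopology "metric (?X, d)" "\<lambda>x. x" "\<lambda>x. q k"]
    by (simp add: c_def T(2) q(1) mtopology_of)
  have c_meas: "c \<in> borel_measurable M"
  proof (rule measurable_coordinatewise_then_product, rule borel_measurableI)
    fix k and S :: "real set" assume "open S"
    then have "openin T {x \<in> topspace T. c x k \<in> S}"
      by (intro openin_continuous_map_preimage[OF cont]) simp
    moreover have "(\<lambda>x. c x k) -` S \<inter> ?X = {x \<in> topspace T. c x k \<in> S}"
      using topT by auto
    ultimately show "(\<lambda>x. c x k) -` S \<inter> ?X \<in> sets M"
      unfolding sets by (intro sigma_sets.Basic) simp
  qed
  have inj: "inj_on c ?X"
  proof (rule inj_onI, rule ccontr)
    fix x y assume xy: "x \<in> ?X" "y \<in> ?X" "c x = c y" "x \<noteq> y"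
    then have "0 < d x y / 2" by simp
    then obtain k where k: "d x (q k) < d x y / 2"
      using q(2)[OF xy(1)] by blast
    have "d y (q k) = d x (q k)"
      using fun_cong[OF xy(3), of k] by (simp add: c_def)
    then show False
      using k triangle[OF xy(1) q(1)[of k] xy(2)] commute[of y "q k"] by simp
  qed
  have openc: "openin (top_of_set (c ` ?X)) (c ` U)" if U: "openin T U" for U
  proof -
    \<comment> \<open>The index set collects the balls around some \<open>q k\<close> that are
      contained in U; in the sequence space each of them is the trace of an open condition on
      coordinate k.\<close>
    define W where "W = (\<Union>(k, r) \<in> {(k, r). \<forall>y\<in>?X. d y (q k) < r \<longrightarrow> y \<in> U}. {p. p k < r})"
    have "U \<subseteq> ?X"
      using openin_subset[OF U] topT by simp
    have "open {p :: nat \<Rightarrow> real. p k < r}" for k r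
      by (rule open_Collect_less[OF continuous_on_product_coordinates continuous_on_const])
    then have "open W"
      unfolding W_def by (intro open_UN) auto
    moreover have "c ` U = c ` ?X \<inter> W"
    proof (intro equalityI subsetI)
      fix p assume "p \<in> c ` U"
      then obtain x where x: "x \<in> U" "p = c x" by blast
      then have "x \<in> ?X" using \<open>U \<subseteq> ?X\<close> by blast
      obtain \<epsilon> where \<epsilon>: "\<epsilon> > 0" "mball x \<epsilon> \<subseteq> U"
        using U x(1) unfolding T(2) openin_mtopology by blast
      obtain k where k: "d x (q k) < \<epsilon> / 2"
        using q(2)[OF \<open>x \<in> ?X\<close>, of "\<epsilon> / 2"] \<epsilon>(1) by auto
      have "y \<in> U" if y: "y \<in> ?X" "d y (q k) < \<epsilon> / 2" for y
      proof -
        have "d x y < \<epsilon>"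
          using triangle[OF \<open>x \<in> ?X\<close> q(1)[of k] y(1)] k y(2) commute[of y "q k"] by simp
        then show ?thesis
          using \<epsilon>(2) y(1) \<open>x \<in> ?X\<close> by auto
      qed
      then have "p \<in> W"
        using k x(2) unfolding W_def c_def by blast
      then show "p \<in> c ` ?X \<inter> W"
        using x(2) \<open>x \<in> ?X\<close> by blast
    qed (auto simp: W_def c_def)
    ultimately show ?thesis
      by (auto simp: openin_open)
  qed
  have "homeomorphic_map T (top_of_set (c ` ?X)) c"
  proof (rule bijective_open_imp_homeomorphic_map)
    have "continuous_map T euclidean c"
      using cont unfolding continuous_map_componentwise_UNIV euclidean_product_topology[symmetric]
      by blast
    then show "continuous_map T (top_of_set (c ` ?X)) c"
      by (simp add: continuous_map_in_subtopology topT)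
    show "open_map T (top_of_set (c ` ?X)) c"
      using openc by (simp add: open_map_def)
  qed (use inj topT in auto)
  then have "completely_metrizable_space (top_of_set (c ` ?X))"
    using T(1) homeomorphic_completely_metrizable_space homeomorphic_map_imp_homeomorphic_space by metis
  \<comment> \<open>Completeness enters here: a completely metrizable subspace of a completely
    metrizable space is a G-delta.\<close>
  then have "gdelta_in euclidean (c ` ?X)"
    by (subst (asm) completely_metrizable_space_eq_gdelta_in)
       (auto intro: completely_metrizable_space_euclidean)
  then obtain D where D: "\<And>n :: nat. open (D n)" "\<Inter> (range D) = c ` ?X"
    unfolding gdelta_in_descending by auto
  then have "\<Inter> (range D) \<in> sets borel"
    using D(1) by (intro sets.countable_INT) auto
  then have cX: "c ` ?X \<in> sets borel"
    unfolding D(2) .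
  have cA: "c ` A \<in> sets borel" if "A \<in> sets M" for A
    using that unfolding sets
  proof (induction rule: sigma_sets.induct)
    case (Basic U)
    then obtain W where "open W" "c ` U = c ` ?X \<inter> W"
      using openc unfolding openin_open by blast
    then show ?case using cX by simp
  next
    case (Compl A)
    have "A \<subseteq> ?X"
      using Compl(1) sets sets.sets_into_space by blast
    then have "c ` (?X - A) = c ` ?X - c ` A"
      using inj by (intro inj_on_image_set_diff) auto
    then show ?case using Compl(2) cX by simp
  next
    case (Union A)
    then show ?case by (simp add: image_UN)
  qed simp
  obtain x0 where x0: "x0 \<in> ?X" using assms(2) by blast
  \<comment> \<open>Off the image any fixed point serves as the value; this is why the space must be
    nonempty.\<close>
  define r where "r = (\<lambda>p. if p \<in> c ` ?X then inv_into ?X c p else x0)"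
  have rc: "r (c x) = x" if "x \<in> ?X" for x
    using that inj by (simp add: r_def)
  have "r \<in> measurable borel M"
  proof (rule measurableI)
    show "r p \<in> ?X" for p
      using x0 by (auto simp: r_def inv_into_into)
    fix A assume A: "A \<in> sets M"
    have "r -` A = c ` A \<union> (if x0 \<in> A then - c ` ?X else {})"
    proof (intro equalityI subsetI)
      fix p assume "p \<in> r -` A"
      then show "p \<in> c ` A \<union> (if x0 \<in> A then - c ` ?X else {})"
      proof (cases "p \<in> c ` ?X")
        case True
        then obtain x where "x \<in> ?X" "p = c x" by blast
        then show ?thesis using \<open>p \<in> r -` A\<close> rc by auto
      next
        case False
        then show ?thesis using \<open>p \<in> r -` A\<close> by (simp add: r_def)
      qed
    next
      fix p assume p: "p \<in> c ` A \<union> (if x0 \<in> A then - c ` ?X else {})"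
      show "p \<in> r -` A"
      proof (cases "p \<in> c ` A")
        case True
        then show ?thesis using rc sets.sets_into_space[OF A] by auto
      next
        case False
        then have "x0 \<in> A" "p \<notin> c ` ?X" using p by (auto split: if_splits)
        then show ?thesis by (simp add: r_def)
      qed
    qed
    then show "r -` A \<inter> space borel \<in> sets borel"
      using cA[OF A] cX by auto
  qed
  with c_meas rc show ?thesis using that by blast
qed

theorem Lusin_Novikov_standard_borel:
  assumes c [measurable]: "c \<in> borel_measurable M" and r [measurable]: "r \<in> measurable borel M"
    and rc: "\<And>x. x \<in> space M \<Longrightarrow> r (c x :: nat \<Rightarrow> real) = x"
    and G [measurable]: "G \<in> sets (M \<Otimes>\<^sub>M M)" and count: "\<And>x. x \<in> space M \<Longrightarrow> countable (G `` {x})"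
  obtains g :: "nat \<Rightarrow> 'a \<Rightarrow> 'a" where "\<forall>i. g i \<in> measurable M M"
    "\<forall>x\<in>space M. range (\<lambda>i. g i x) = insert x (G `` {x})"
proof -
  \<comment> \<open>The graph is transported to codes. A sequence p is the code of a point exactly
    if \<open>c (r p) = p\<close>, and restricting to such p keeps the fibres countable.\<close>
  define P where "P = {p. c (r (fst p)) = fst p \<and> c (r (snd p)) = snd p \<and> (r (fst p), r (snd p)) \<in> G}"
  have "{p \<in> space (borel \<Otimes>\<^sub>M borel). c (r (fst p)) = fst p \<and> c (r (snd p)) = snd p \<and>
      (r (fst p), r (snd p)) \<in> G} \<in> sets (borel \<Otimes>\<^sub>M borel)"
    by measurable
  then have "P \<in> sets (borel \<Otimes>\<^sub>M borel)"
    by (simp add: P_def space_pair_measure)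
  then have "P \<in> sets borel"
    by (simp only: borel_prod)
  moreover have "countable (P `` {p})" for p
  proof -
    have "P `` {p} \<subseteq> c ` (G `` {r p})"
      unfolding P_def by force
    moreover have "countable (G `` {r p})"
      using measurable_space[OF r, of p] by (intro count) simp
    ultimately show ?thesis
      by (meson countable_image countable_subset)
  qed
  ultimately obtain h where h [measurable]: "\<And>i :: nat. h i \<in> borel_measurable borel" and P: "P \<subseteq> graphs h"
    using Lusin_Novikov[of P] by blast
  \<comment> \<open>Index 0 is the identity, and a candidate that is not a neighbour is replaced by
    x itself, so every map is total. This is why the range contains x as well.\<close>
  define g where "g = (\<lambda>i x. case i of 0 \<Rightarrow> x
      | Suc j \<Rightarrow> if (x, r (h j (c x))) \<in> G then r (h j (c x)) else x)"
  have g_meas: "g i \<in> measurable M M" for i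
    unfolding g_def by (cases i) (simp_all, measurable)
  have "range (\<lambda>i. g i x) = insert x (G `` {x})" if x: "x \<in> space M" for x
  proof (intro equalityI subsetI)
    fix y assume "y \<in> insert x (G `` {x})"
    then consider "y = x" | "(x, y) \<in> G" by auto
    then show "y \<in> range (\<lambda>i. g i x)"
    proof cases
      case 1
      then show ?thesis by (intro range_eqI[of _ _ 0]) (simp add: g_def)
    next
      case 2
      then have "y \<in> space M"
        using sets.sets_into_space[OF G] by (auto simp: space_pair_measure)
      then have "(c x, c y) \<in> P"
        using 2 x by (simp add: P_def rc)
      then obtain j where "c y = h j (c x)"
        using P by (auto simp: graphs_def)
      then have "r (h j (c x)) = y"
        using rc[OF \<open>y \<in> space M\<close>] by metis
      then show ?thesis
        using 2 by (intro range_eqI[of _ _ "Suc j"]) (simp add: g_def)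
    qed
  qed (auto simp: g_def split: nat.splits if_splits)
  with g_meas show ?thesis using that by blast
qed


section \<open>Hyperfiniteness from selectors\<close>

definition hyperfinite_eqrel :: "'a measure \<Rightarrow> ('a \<times> 'a) set \<Rightarrow> bool" where
  "hyperfinite_eqrel M E \<longleftrightarrow>
     (\<exists>F :: nat \<Rightarrow> ('a \<times> 'a) set.
        (\<forall>n. F n \<in> sets (M \<Otimes>\<^sub>M M) \<and> equiv (space M) (F n) \<and>
             (\<forall>x\<in>space M. finite (F n `` {x}))) \<and>
        incseq F \<and> E = (\<Union>n. F n))"

text \<open>The maps \<open>e\<close> turn quantifiers over a class into countable ones; the
  injection \<open>c\<close> into real sequences makes equality of points measurable.\<close>

locale countable_borel_eqrel =
  fixes M :: "'a measure" and E :: "('a \<times> 'a) set"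
    and e :: "nat \<Rightarrow> 'a \<Rightarrow> 'a" and c :: "'a \<Rightarrow> nat \<Rightarrow> real"
  assumes equiv: "equiv (space M) E"
    and e_measurable [measurable]: "\<And>i. e i \<in> measurable M M"
    and E_iff: "\<And>x y. x \<in> space M \<Longrightarrow> (x, y) \<in> E \<longleftrightarrow> (\<exists>i. y = e i x)"
    and c_measurable [measurable]: "c \<in> borel_measurable M"
    and c_inj: "inj_on c (space M)"
begin

lemma e_space [simp]: "x \<in> space M \<Longrightarrow> e i x \<in> space M"
  using measurable_space[OF e_measurable] .

lemma E_space: "(x, y) \<in> E \<Longrightarrow> x \<in> space M \<and> y \<in> space M"
  using equiv by (auto simp: equiv_def refl_on_def)

lemma E_refl: "x \<in> space M \<Longrightarrow> (x, x) \<in> E"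
  using equiv by (auto simp: equiv_def refl_on_def)

lemma E_sym: "(x, y) \<in> E \<Longrightarrow> (y, x) \<in> E"
  using equiv by (auto simp: equiv_def sym_def)

lemma E_trans: "(x, y) \<in> E \<Longrightarrow> (y, z) \<in> E \<Longrightarrow> (x, z) \<in> E"
  using equiv by (auto simp: equiv_def trans_def)

lemma pred_eq:
  assumes [measurable]: "f \<in> measurable N M" "g \<in> measurable N M"
  shows "Measurable.pred N (\<lambda>x. f x = g x)"
proof -
  have "Measurable.pred N (\<lambda>x. c (f x) = c (g x))"
    by measurable
  moreover have "c (f x) = c (g x) \<longleftrightarrow> f x = g x" if "x \<in> space N" for x
    using inj_on_eq_iff[OF c_inj] measurable_space[OF assms(1) that] measurable_space[OF assms(2) that]
    by simp
  ultimately show ?thesis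
    by (simp cong: measurable_cong)
qed

lemma pred_pair:
  assumes "Measurable.pred (M \<Otimes>\<^sub>M M) (\<lambda>(x, y). R x y)" "f \<in> measurable N M" "g \<in> measurable N M"
  shows "Measurable.pred N (\<lambda>x. R (f x) (g x))"
  using measurable_compose[OF measurable_Pair[OF assms(2,3)] assms(1)] by simp

lemma ex_E_iff:
  assumes "x \<in> space M" "\<And>y. R y \<Longrightarrow> (x, y) \<in> E"
  shows "(\<exists>y. R y) \<longleftrightarrow> (\<exists>i. R (e i x))"
  using assms E_iff by metis

text \<open>A point determined uniquely within its class is found as \<open>e i x\<close> for the
  least index i that passes the test.\<close>

lemma measurable_selection:
  assumes [measurable]: "\<And>i. Measurable.pred M (\<lambda>x. R x (e i x))"
    and "\<And>x. x \<in> space M \<Longrightarrow> (x, s x) \<in> E \<and> R x (s x)"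
    and uniq: "\<And>x y. x \<in> space M \<Longrightarrow> R x y \<Longrightarrow> y = s x"
  shows "s \<in> measurable M M"
proof -
  have "(\<lambda>x. e (LEAST i. R x (e i x)) x) \<in> measurable M M"
    by (rule measurable_compose_countable) measurable
  moreover have "e (LEAST i. R x (e i x)) x = s x" if "x \<in> space M" for x
  proof -
    have "\<exists>i. R x (e i x)"
      using assms(2)[OF that] E_iff[OF that] by metis
    then show ?thesis
      using uniq[OF that] LeastI_ex[of "\<lambda>i. R x (e i x)"] by blast
  qed
  ultimately show ?thesis
    by (simp cong: measurable_cong)
qed

text \<open>The kernels of the maps \<open>a n\<close> increase to \<open>E\<close> but may have
  infinite classes. The way back from \<open>a (Suc n) x\<close> to \<open>a n x\<close> is recorded
  by one number \<open>k n x\<close>; bounding the level and the recorded numbers by n leaves only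
  finitely many points in a class.\<close>

theorem hyperfinite_if_selectors:
  fixes a :: "nat \<Rightarrow> 'a \<Rightarrow> 'a"
  assumes a_meas [measurable]: "\<And>n. a n \<in> measurable M M"
    and a0: "\<And>x. a 0 x = x"
    and aE: "\<And>n x. x \<in> space M \<Longrightarrow> (x, a n x) \<in> E"
    and step: "\<And>n x y. x \<in> space M \<Longrightarrow> y \<in> space M \<Longrightarrow> a n x = a n y \<Longrightarrow> a (Suc n) x = a (Suc n) y"
    and ex: "\<And>x y. (x, y) \<in> E \<Longrightarrow> \<exists>n. a n x = a n y"
  shows "hyperfinite_eqrel M E"
proof -
  define k where "k = (\<lambda>n x. LEAST i. e i (a (Suc n) x) = a n x)"
  have [measurable]: "Measurable.pred M (\<lambda>x. e i (a (Suc n) x) = a n x)" for i n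
    by (rule pred_eq) measurable
  have k_meas [measurable]: "k n \<in> measurable M (count_space UNIV)" for n
    unfolding k_def by measurable
  have k: "e (k n x) (a (Suc n) x) = a n x" if x: "x \<in> space M" for n x
  proof -
    have "(a (Suc n) x, a n x) \<in> E"
      using aE[OF x] E_sym E_trans by blast
    then have "\<exists>i. e i (a (Suc n) x) = a n x"
      using E_iff E_space by metis
    then show ?thesis
      unfolding k_def by (rule LeastI_ex)
  qed
  have mono: "a i x = a i y" if "x \<in> space M" "y \<in> space M" "a m x = a m y" "m \<le> i" for i m x y
    using that(4)
  proof (induction rule: dec_induct)
    case base
    show ?case by (rule that(3))
  next
    case (step l)
    then show ?case using assms(4) that(1,2) by blast
  qed
  have k_eq: "k i x = k i y" if "x \<in> space M" "y \<in> space M" "a m x = a m y" "m \<le> i" for i m x y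
    using mono[OF that] mono[OF that(1-3), of "Suc i"] that(4) by (simp add: k_def)
  \<comment> \<open>\<open>a 0 y = y\<close> can be recovered from \<open>a m y\<close> and the indices \<open>k i y\<close> with \<open>i < m\<close>. The relation is
    transitive because \<open>k i x\<close> depends only on \<open>a m x\<close> once \<open>m \<le> i\<close>.\<close>
  define F where "F = (\<lambda>n. {(x, y). x \<in> space M \<and> y \<in> space M \<and>
      (\<exists>m. m \<le> n \<and> a m x = a m y \<and> (\<forall>i. i < m \<longrightarrow> k i x \<le> n \<and> k i y \<le> n))})"
  have "F n \<in> sets (M \<Otimes>\<^sub>M M)" for n
  proof -
    have [measurable]: "Measurable.pred (M \<Otimes>\<^sub>M M) (\<lambda>p. a m (fst p) = a m (snd p))" for m
      by (rule pred_eq) measurable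
    have "{p \<in> space (M \<Otimes>\<^sub>M M). \<exists>m. m \<le> n \<and> a m (fst p) = a m (snd p) \<and>
        (\<forall>i. i < m \<longrightarrow> k i (fst p) \<le> n \<and> k i (snd p) \<le> n)} \<in> sets (M \<Otimes>\<^sub>M M)"
      by measurable
    moreover have "F n = {p \<in> space (M \<Otimes>\<^sub>M M). \<exists>m. m \<le> n \<and> a m (fst p) = a m (snd p) \<and>
        (\<forall>i. i < m \<longrightarrow> k i (fst p) \<le> n \<and> k i (snd p) \<le> n)}"
      unfolding F_def space_pair_measure by auto
    ultimately show ?thesis by simp
  qed
  moreover have "equiv (space M) (F n)" for n
  proof (rule equivI)
    show "F n \<subseteq> space M \<times> space M"
      by (auto simp: F_def)
    show "refl_on (space M) (F n)"
      by (auto simp: F_def refl_on_def intro!: exI[of _ 0])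
    show "sym (F n)"
      unfolding F_def sym_def by simp metis
    show "trans (F n)"
    proof (rule transI)
      fix x y z assume "(x, y) \<in> F n" "(y, z) \<in> F n"
      then obtain l m where S: "x \<in> space M" "y \<in> space M" "z \<in> space M"
        and l: "l \<le> n" "a l x = a l y" "\<forall>i<l. k i x \<le> n \<and> k i y \<le> n"
        and m: "m \<le> n" "a m y = a m z" "\<forall>i<m. k i y \<le> n \<and> k i z \<le> n"
        by (auto simp: F_def)
      have "a (max l m) x = a (max l m) z"
        using mono[OF S(1,2) l(2), of "max l m"] mono[OF S(2,3) m(2), of "max l m"] by simp
      moreover have "k i x \<le> n \<and> k i z \<le> n" if "i < max l m" for i
        using that l(3) m(3) k_eq[OF S(1,2) l(2), of i] k_eq[OF S(2,3) m(2), of i]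
        by (cases "i < l"; cases "i < m") auto
      ultimately show "(x, z) \<in> F n"
        using S l(1) m(1) by (auto simp: F_def intro!: exI[of _ "max l m"])
    qed
  qed
  moreover have "finite (F n `` {x})" if x: "x \<in> space M" for n x
  proof -
    \<comment> \<open>Decoding: from \<open>a m y\<close> the recorded indices lead back level by
      level to y, so a class of \<open>F n\<close> injects into finitely many bounded words.\<close>
    have rec: "foldr e (map (\<lambda>i. k i y) [0..<m]) (a m y) = y" if "y \<in> space M" for y m
      by (induction m) (simp_all add: a0 k[OF that])
    have "F n `` {x} \<subseteq> (\<Union>m\<le>n. (\<lambda>l. foldr e l (a m x)) ` {l. set l \<subseteq> {..n} \<and> length l = m})"
    proof
      fix y assume "y \<in> F n `` {x}"
      then obtain m where m: "m \<le> n" "a m x = a m y" "\<forall>i<m. k i y \<le> n" "y \<in> space M"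
        by (auto simp: F_def)
      then have "y = foldr e (map (\<lambda>i. k i y) [0..<m]) (a m x)"
        by (simp add: rec)
      then show "y \<in> (\<Union>m\<le>n. (\<lambda>l. foldr e l (a m x)) ` {l. set l \<subseteq> {..n} \<and> length l = m})"
        using m by (intro UN_I[of m] image_eqI[of _ _ "map (\<lambda>i. k i y) [0..<m]"]) auto
    qed
    moreover have "finite (\<Union>m\<le>n. (\<lambda>l. foldr e l (a m x)) ` {l. set l \<subseteq> {..n} \<and> length l = m})"
      by (intro finite_UN_I finite_imageI finite_lists_length_eq) auto
    ultimately show ?thesis
      by (rule finite_subset)
  qed
  moreover have "incseq F"
    unfolding F_def by (rule incseq_SucI) (simp add: subset_iff, meson le_SucI)
  moreover have "E = (\<Union>n. F n)"
  proof (intro equalityI subsetI; clarify)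
    fix x y assume xy: "(x, y) \<in> E"
    then obtain m where m: "a m x = a m y"
      using ex by blast
    define n where "n = m + (\<Sum>i<m. k i x + k i y)"
    have "k i x + k i y \<le> n" if "i < m" for i
      using member_le_sum[of i "{..<m}" "\<lambda>i. k i x + k i y"] that by (simp add: n_def)
    then have "k i x \<le> n \<and> k i y \<le> n" if "i < m" for i
      using that by (meson add_leE)
    then have "(x, y) \<in> F n"
      using m E_space[OF xy] by (auto simp: F_def n_def intro!: exI[of _ m])
    then show "(x, y) \<in> (\<Union>n. F n)" by blast
  next
    fix x y n assume "(x, y) \<in> F n"
    then obtain m where "x \<in> space M" "y \<in> space M" "a m x = a m y"
      by (auto simp: F_def)
    then show "(x, y) \<in> E"
      using aE[of x m] aE[of y m] E_sym E_trans by metis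
  qed
  ultimately show ?thesis
    unfolding hyperfinite_eqrel_def by blast
qed

end


section \<open>Hyperfiniteness from forest orders\<close>

locale borel_forest = countable_borel_eqrel +
  fixes le :: "'a \<Rightarrow> 'a \<Rightarrow> bool"
  assumes le_measurable: "Measurable.pred (M \<Otimes>\<^sub>M M) (\<lambda>(x, y). le x y)"
    and le_E: "\<And>x y. le x y \<Longrightarrow> (x, y) \<in> E"
    and le_refl: "\<And>x. x \<in> space M \<Longrightarrow> le x x"
    and le_trans: "\<And>x y z. le x y \<Longrightarrow> le y z \<Longrightarrow> le x z"
    and le_antisym: "\<And>x y. le x y \<Longrightarrow> le y x \<Longrightarrow> x = y"
    and le_linear: "\<And>x y z. le x y \<Longrightarrow> le x z \<Longrightarrow> le y z \<or> le z y"
    and le_finite: "\<And>x z. le x z \<Longrightarrow> finite {y. le x y \<and> le y z}"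
    and le_directed: "\<And>x y. (x, y) \<in> E \<Longrightarrow> \<exists>z. le x z \<and> le y z"
begin

lemma le_space: "le x y \<Longrightarrow> x \<in> space M \<and> y \<in> space M"
  using le_E E_space by blast

section \<open>Cofinal sets along upward chains\<close>

text \<open>The strictness \<open>u \<noteq> z\<close> is deliberate:
  \<open>cofinal (space M) x\<close> thereby says that no point above x is maximal.\<close>

definition cofinal :: "'a set \<Rightarrow> 'a \<Rightarrow> bool" where
  "cofinal S x \<longleftrightarrow> (\<forall>z. le x z \<longrightarrow> (\<exists>u\<in>S. le z u \<and> u \<noteq> z))"

lemma cofinal_upward:
  assumes "le x y"
  shows "cofinal S x \<longleftrightarrow> cofinal S y"
proof
  assume "cofinal S x"
  then show "cofinal S y"
    using assms le_trans unfolding cofinal_def by blast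
next
  assume y: "cofinal S y"
  show "cofinal S x"
    unfolding cofinal_def
  proof (intro allI impI)
    fix z assume z: "le x z"
    show "\<exists>u\<in>S. le z u \<and> u \<noteq> z"
    proof (cases "le y z")
      case True
      then show ?thesis using y unfolding cofinal_def by blast
    next
      case False
      then have "le z y" using le_linear[OF assms z] by blast
      obtain u where "u \<in> S" "le y u" "u \<noteq> y"
        using y le_refl le_space[OF assms] unfolding cofinal_def by blast
      then show ?thesis
        using \<open>le z y\<close> le_trans le_antisym by blast
    qed
  qed
qed

text \<open>Related points share a tail of their chains, by directedness. This is what allows
  cofinality to steer choices that must be uniform on a class.\<close>

lemma cofinal_invariant:
  assumes "(x, y) \<in> E"
  shows "cofinal S x \<longleftrightarrow> cofinal S y"
  using le_directed[OF assms] cofinal_upward by blast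

text \<open>If B fails to meet S cofinally, then past some point of the chain all of S lies outside
  B.\<close>

lemma cofinal_split:
  assumes "cofinal S x" "\<not> cofinal (S \<inter> B) x"
  shows "cofinal (S - B) x"
proof -
  obtain z0 where z0: "le x z0" "\<And>u. u \<in> S \<inter> B \<Longrightarrow> le z0 u \<Longrightarrow> u = z0"
    using assms(2) unfolding cofinal_def by blast
  have "cofinal (S - B) z0"
    unfolding cofinal_def
  proof (intro allI impI)
    fix z assume z: "le z0 z"
    then obtain u where u: "u \<in> S" "le z u" "u \<noteq> z"
      using assms(1) z0(1) le_trans unfolding cofinal_def by blast
    then have "u \<notin> B"
      using z0(2)[of u] z le_trans le_antisym by blast
    then show "\<exists>u\<in>S - B. le z u \<and> u \<noteq> z"
      using u by blast
  qed
  then show ?thesis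
    using cofinal_upward[OF z0(1)] by blast
qed

lemma cofinal_measurable:
  assumes [measurable]: "S \<in> sets M"
  shows "Measurable.pred M (cofinal S)"
proof -
  have [measurable]: "Measurable.pred M (\<lambda>x. le x (e i x))"
    "Measurable.pred M (\<lambda>x. le (e i x) (e j (e i x)))"
    "Measurable.pred M (\<lambda>x. e j (e i x) = e i x)" for i j
    by (rule pred_pair[OF le_measurable] pred_eq; measurable)+
  have "Measurable.pred M (\<lambda>x. \<forall>i. le x (e i x) \<longrightarrow>
      (\<exists>j. e j (e i x) \<in> S \<and> le (e i x) (e j (e i x)) \<and> e j (e i x) \<noteq> e i x))"
    by measurable
  moreover have "cofinal S x \<longleftrightarrow> (\<forall>i. le x (e i x) \<longrightarrow>
      (\<exists>j. e j (e i x) \<in> S \<and> le (e i x) (e j (e i x)) \<and> e j (e i x) \<noteq> e i x))" if x: "x \<in> space M" for x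
  proof -
    have "(\<exists>u. u \<in> S \<and> le z u \<and> u \<noteq> z) \<longleftrightarrow> (\<exists>j. e j z \<in> S \<and> le z (e j z) \<and> e j z \<noteq> z)"
      if "z \<in> space M" for z
      by (rule ex_E_iff[OF that]) (use le_E in blast)
    then have "(\<exists>z. le x z \<and> \<not> (\<exists>u. u \<in> S \<and> le z u \<and> u \<noteq> z)) \<longleftrightarrow>
        (\<exists>i. le x (e i x) \<and> \<not> (\<exists>j. e j (e i x) \<in> S \<and> le (e i x) (e j (e i x)) \<and> e j (e i x) \<noteq> e i x))"
      using ex_E_iff[OF x, of "\<lambda>z. le x z \<and> \<not> (\<exists>u. u \<in> S \<and> le z u \<and> u \<noteq> z)"] le_E e_space[OF x]
      by simp
    then show ?thesis
      unfolding cofinal_def by (auto simp: Bex_def)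
  qed
  ultimately show ?thesis
    by (simp cong: measurable_cong)
qed

section \<open>A decreasing sequence of cofinal markers that vanishes\<close>

text \<open>A sequence of Borel sets that separates points: coordinate k of the code lies below the
  l-th rational.\<close>

definition halfspace :: "nat \<Rightarrow> 'a set" where
  "halfspace n = (case prod_decode n of (k, l) \<Rightarrow> {x \<in> space M. c x k < from_nat_into \<rat> l})"

lemma halfspace_measurable [measurable]: "halfspace n \<in> sets M"
proof -
  have [measurable]: "(\<lambda>x. c x k) \<in> borel_measurable M" for k
    using measurable_compose[OF c_measurable measurable_product_coordinates] by simp
  show ?thesis
    unfolding halfspace_def by (auto split: prod.split)
qed

lemma halfspace_separates:
  assumes xy: "x \<in> space M" "y \<in> space M" and eq: "\<And>n. x \<in> halfspace n \<longleftrightarrow> y \<in> halfspace n"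
  shows "x = y"
proof -
  have *: "c x k < q \<longleftrightarrow> c y k < q" if "q \<in> \<rat>" for k q
  proof -
    obtain l where "from_nat_into \<rat> l = q"
      using from_nat_into_surj[OF countable_rat \<open>q \<in> \<rat>\<close>] by blast
    then show ?thesis
      using eq[of "prod_encode (k, l)"] xy by (simp add: halfspace_def)
  qed
  have "c x k = c y k" for k
    using Rats_dense_in_real[of "c x k" "c y k"] Rats_dense_in_real[of "c y k" "c x k"] *
    by (metis linorder_neqE not_less_iff_gr_or_eq)
  then show ?thesis
    using inj_onD[OF c_inj] xy by blast
qed

text \<open>On each class the sequence \<open>cell n\<close> chooses one half of the previous set, always one that is
  cofinal if possible; so it shrinks to at most one point.\<close>

primrec cell :: "nat \<Rightarrow> 'a set" where
  "cell 0 = space M"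
| "cell (Suc n) = {z \<in> cell n. z \<in> halfspace n \<longleftrightarrow> cofinal (cell n \<inter> halfspace n) z}"

lemma cell_measurable [measurable]: "cell n \<in> sets M"
proof (induction n)
  case (Suc n)
  note [measurable] = Suc cofinal_measurable[OF sets.Int[OF Suc halfspace_measurable]]
  have "{z \<in> space M. z \<in> cell n \<and> (z \<in> halfspace n \<longleftrightarrow> cofinal (cell n \<inter> halfspace n) z)} \<in> sets M"
    by measurable
  moreover have "cell (Suc n) = {z \<in> space M. z \<in> cell n \<and>
      (z \<in> halfspace n \<longleftrightarrow> cofinal (cell n \<inter> halfspace n) z)}"
    using sets.sets_into_space[OF Suc] by auto
  ultimately show ?case by simp
qed simp

lemma cell_antimono: "m \<le> n \<Longrightarrow> cell n \<subseteq> cell m"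
  by (induction rule: dec_induct) auto

lemma cofinal_cell:
  assumes "cofinal (space M) x"
  shows "cofinal (cell n) x"
proof (induction n)
  case (Suc n)
  have inv: "cofinal (cell n \<inter> halfspace n) u \<longleftrightarrow> cofinal (cell n \<inter> halfspace n) x"
    if "le x z" "le z u" for z u
    using cofinal_upward le_trans[OF that] by blast
  show ?case
  proof (cases "cofinal (cell n \<inter> halfspace n) x")
    case True
    show ?thesis
      unfolding cofinal_def
    proof (intro allI impI)
      fix z assume z: "le x z"
      then obtain u where "u \<in> cell n \<inter> halfspace n" "le z u" "u \<noteq> z"
        using True unfolding cofinal_def by blast
      then show "\<exists>u\<in>cell (Suc n). le z u \<and> u \<noteq> z"
        using inv[OF z] True by auto
    qed
  next
    case False
    show ?thesis
      unfolding cofinal_def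
    proof (intro allI impI)
      fix z assume z: "le x z"
      then obtain u where "u \<in> cell n - halfspace n" "le z u" "u \<noteq> z"
        using cofinal_split[OF Suc False] unfolding cofinal_def by blast
      then show "\<exists>u\<in>cell (Suc n). le z u \<and> u \<noteq> z"
        using inv[OF z] False by auto
    qed
  qed
qed (simp add: assms)

text \<open>The test that picks a half is class invariant, so two related points that survive every
  stage lie on the same side of every \<open>halfspace n\<close>.\<close>

lemma cell_limit_unique:
  assumes "(x, y) \<in> E" "\<And>n. x \<in> cell n" "\<And>n. y \<in> cell n"
  shows "x = y"
proof (rule halfspace_separates)
  show "x \<in> halfspace n \<longleftrightarrow> y \<in> halfspace n" for n
    using assms(2,3)[of "Suc n"] cofinal_invariant[OF assms(1)] by simp
qed (use E_space[OF assms(1)] in auto)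

definition maximal :: "'a \<Rightarrow> bool" where
  "maximal z \<longleftrightarrow> (\<forall>u. le z u \<longrightarrow> u = z)"

text \<open>Where chains have no last point, the markers are the cells without their common point,
  which would never vanish. Elsewhere the class has a greatest point by directedness, and that point
  is a marker at every stage.\<close>

definition marker :: "nat \<Rightarrow> 'a set" where
  "marker n = {z \<in> space M. if cofinal (space M) z then z \<in> cell n \<and> (\<exists>m. z \<notin> cell m) else maximal z}"

lemma marker_measurable [measurable]: "marker n \<in> sets M"
proof -
  note [measurable] = cofinal_measurable[OF sets.top]
  have [measurable]: "Measurable.pred M (\<lambda>z. le z (e i z))" "Measurable.pred M (\<lambda>z. e i z = z)" for i
    by (rule pred_pair[OF le_measurable] pred_eq; measurable)+
  have "{z \<in> space M. if cofinal (space M) z then z \<in> cell n \<and> (\<exists>m. z \<notin> cell m)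
      else (\<forall>i. le z (e i z) \<longrightarrow> e i z = z)} \<in> sets M"
    by measurable
  moreover have "maximal z \<longleftrightarrow> (\<forall>i. le z (e i z) \<longrightarrow> e i z = z)" if "z \<in> space M" for z
    unfolding maximal_def using ex_E_iff[OF that, of "\<lambda>u. le z u \<and> u \<noteq> z"] le_E by blast
  then have "marker n = {z \<in> space M. if cofinal (space M) z then z \<in> cell n \<and> (\<exists>m. z \<notin> cell m)
      else (\<forall>i. le z (e i z) \<longrightarrow> e i z = z)}"
    unfolding marker_def by auto
  ultimately show ?thesis by simp
qed

lemma marker_antimono: "marker (Suc n) \<subseteq> marker n"
  by (auto simp: marker_def)

lemma marker_above:
  assumes x: "x \<in> space M"
  shows "\<exists>z\<in>marker n. le x z"
proof (cases "cofinal (space M) x")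
  case True
  note cof = cofinal_cell[OF True, of n, unfolded cofinal_def, rule_format]
  obtain u where u: "u \<in> cell n" "le x u"
    using cof[OF le_refl[OF x]] by blast
  \<comment> \<open>Two cell points above x are taken because at most one point of the class lies in
    all cells; the other one is a marker.\<close>
  obtain v where v: "v \<in> cell n" "le u v" "v \<noteq> u"
    using cof[OF u(2)] by blast
  have "le x v" using u v le_trans by blast
  have "(\<exists>m. u \<notin> cell m) \<or> (\<exists>m. v \<notin> cell m)"
    using cell_limit_unique[OF le_E[OF v(2)]] v(3) by blast
  moreover have "cofinal (space M) u" "cofinal (space M) v" "u \<in> space M" "v \<in> space M"
    using True u(2) \<open>le x v\<close> cofinal_upward le_space by blast+
  ultimately have "u \<in> marker n \<or> v \<in> marker n"
    using u v by (auto simp: marker_def)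
  then show ?thesis using u(2) \<open>le x v\<close> by blast
next
  case False
  then obtain z where z: "le x z" "\<And>u. u \<in> space M \<Longrightarrow> le z u \<Longrightarrow> u = z"
    unfolding cofinal_def by blast
  then have "z \<in> marker n"
    using False cofinal_upward[OF z(1)] le_space by (auto simp: marker_def maximal_def)
  with z show ?thesis by blast
qed

lemma marker_vanishes:
  assumes "z \<in> space M" "\<not> maximal z"
  shows "\<exists>N. \<forall>n\<ge>N. z \<notin> marker n"
proof (cases "\<exists>m. z \<notin> cell m")
  case True
  then show ?thesis
    using cell_antimono assms unfolding marker_def by auto
next
  case False
  then show ?thesis
    using assms by (auto simp: marker_def)
qed

section \<open>The first marker above a point\<close>

definition first_marker :: "nat \<Rightarrow> 'a \<Rightarrow> 'a" where
  "first_marker n x = (THE z. z \<in> marker n \<and> le x z \<and> (\<forall>u\<in>marker n. le x u \<longrightarrow> le z u))"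

lemma first_marker_eqI:
  assumes "z \<in> marker n" "le x z" "\<And>u. u \<in> marker n \<Longrightarrow> le x u \<Longrightarrow> le z u"
  shows "first_marker n x = z"
  unfolding first_marker_def using assms le_antisym by (intro the_equality) blast+

text \<open>The marker with the smallest interval \<open>D z\<close> is the least one: by linearity
  any other is above it or has a strictly smaller interval.\<close>

lemma first_marker:
  assumes "x \<in> space M"
  shows "first_marker n x \<in> marker n" "le x (first_marker n x)"
    "\<And>u. u \<in> marker n \<Longrightarrow> le x u \<Longrightarrow> le (first_marker n x) u"
proof -
  define D where "D = (\<lambda>z. {y. le x y \<and> le y z})"
  obtain z where z: "z \<in> marker n" "le x z"
      and min: "\<And>u. u \<in> marker n \<Longrightarrow> le x u \<Longrightarrow> card (D z) \<le> card (D u)"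
    using marker_above[OF assms, of n]
      ex_has_least_nat[of "\<lambda>z. z \<in> marker n \<and> le x z" _ "\<lambda>z. card (D z)"] by metis
  have "le z u" if u: "u \<in> marker n" "le x u" for u
  proof (rule ccontr)
    assume nle: "\<not> le z u"
    then have "le u z" using le_linear[OF z(2) u(2)] by blast
    then have "D u \<subset> D z"
      using nle z le_trans le_refl le_space[OF z(2)] by (auto simp: D_def psubset_eq)
    then have "card (D u) < card (D z)"
      using le_finite[OF z(2)] by (intro psubset_card_mono) (auto simp: D_def)
    with min[OF u] show False by simp
  qed
  with z show "first_marker n x \<in> marker n" "le x (first_marker n x)"
    "\<And>u. u \<in> marker n \<Longrightarrow> le x u \<Longrightarrow> le (first_marker n x) u"
    using first_marker_eqI[of z n x] by auto
qed

text \<open>Markers decrease, so every later marker above x is already above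
  \<open>first_marker n x\<close>. Hence the kernels of the maps increase.\<close>

lemma first_marker_Suc:
  assumes "x \<in> space M"
  shows "first_marker (Suc n) x = first_marker (Suc n) (first_marker n x)"
proof (rule first_marker_eqI)
  let ?z = "first_marker n x"
  note z = first_marker[OF assms, where n = n]
  have "?z \<in> space M" using le_space[OF z(2)] by blast
  note v = first_marker[OF this, where n = "Suc n"]
  show "first_marker (Suc n) ?z \<in> marker (Suc n)" by (rule v)
  show "le x (first_marker (Suc n) ?z)" using z(2) v(2) le_trans by blast
  show "le (first_marker (Suc n) ?z) u" if "u \<in> marker (Suc n)" "le x u" for u
    using that marker_antimono z(3) v(3) by blast
qed

lemma first_marker_measurable [measurable]: "first_marker n \<in> measurable M M"
proof (rule measurable_selection)
  let ?R = "\<lambda>x z. z \<in> marker n \<and> le x z \<and> (\<forall>i. e i x \<in> marker n \<longrightarrow> le x (e i x) \<longrightarrow> le z (e i x))"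
  have all: "(\<forall>i. e i x \<in> marker n \<longrightarrow> le x (e i x) \<longrightarrow> le z (e i x)) \<longleftrightarrow>
      (\<forall>u\<in>marker n. le x u \<longrightarrow> le z u)" if "x \<in> space M" for x z
    using ex_E_iff[OF that, of "\<lambda>u. u \<in> marker n \<and> le x u \<and> \<not> le z u"] le_E by blast
  show "Measurable.pred M (\<lambda>x. ?R x (e i x))" for i
  proof -
    have [measurable]: "Measurable.pred M (\<lambda>x. le x (e j x))" "Measurable.pred M (\<lambda>x. le (e i x) (e j x))" for j
      by (rule pred_pair[OF le_measurable]; measurable)+
    show ?thesis by measurable
  qed
  show "(x, first_marker n x) \<in> E \<and> ?R x (first_marker n x)" if "x \<in> space M" for x
    using first_marker[OF that] le_E by blast
  show "y = first_marker n x" if "x \<in> space M" "?R x y" for x y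
    using that(2) first_marker_eqI[of y n x] unfolding all[OF that(1)] by simp
qed

theorem hyperfinite: "hyperfinite_eqrel M E"
proof (rule hyperfinite_if_selectors)
  let ?a = "case_nat (\<lambda>x. x) first_marker"
  show "?a n \<in> measurable M M" for n
    by (cases n) simp_all
  show "?a 0 x = x" for x by simp
  show "(x, ?a n x) \<in> E" if "x \<in> space M" for n x
    using E_refl[OF that] le_E[OF first_marker(2)[OF that]] by (cases n) auto
  show "?a (Suc n) x = ?a (Suc n) y" if "x \<in> space M" "y \<in> space M" "?a n x = ?a n y" for n x y
    using that first_marker_Suc by (cases n) auto
  fix x y assume xy: "(x, y) \<in> E"
  then obtain z where z: "le x z" "le y z"
    using le_directed by blast
  have S: "x \<in> space M" "y \<in> space M" "z \<in> space M"
    using E_space[OF xy] le_space[OF z(1)] by auto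
  \<comment> \<open>Finitely many points lie between x or y and z. From a late stage on, none of
    them is a marker unless it is maximal, so both first markers have moved up to or beyond z and
    coincide.\<close>
  define D where "D = {u. le x u \<and> le u z} \<union> {u. le y u \<and> le u z}"
  have "finite D"
    using le_finite z by (simp add: D_def)
  have "\<forall>u\<in>D. \<exists>N. \<forall>n\<ge>N. u \<in> marker n \<longrightarrow> maximal u"
  proof
    fix u assume "u \<in> D"
    then have "u \<in> space M" using le_space by (auto simp: D_def)
    then show "\<exists>N. \<forall>n\<ge>N. u \<in> marker n \<longrightarrow> maximal u"
      using marker_vanishes[of u] by (cases "maximal u") auto
  qed
  then obtain N where N: "\<And>u n. u \<in> D \<Longrightarrow> N u \<le> n \<Longrightarrow> u \<in> marker n \<Longrightarrow> maximal u"
    by metis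
  define n where "n = Max (N ` D)"
  have max: "maximal u" if "u \<in> D" "u \<in> marker n" for u
    using N[OF that(1) _ that(2)] \<open>finite D\<close> that(1) by (simp add: n_def)
  have above: "le z (first_marker n p)" if p: "p \<in> {x, y}" for p
  proof -
    have p': "p \<in> space M" "le p z" using p S z by auto
    note v = first_marker[OF p'(1), where n = n]
    show ?thesis
    proof (cases "le (first_marker n p) z")
      case True
      then have "maximal (first_marker n p)"
        using v p by (intro max) (auto simp: D_def)
      then have "z = first_marker n p"
        using True by (simp add: maximal_def)
      then show ?thesis using le_refl[OF S(3)] by simp
    next
      case False
      then show ?thesis using le_linear[OF v(2) p'(2)] by blast
    qed
  qed
  have "first_marker n x = first_marker n y"
    using first_marker[OF S(1), where n = n] first_marker[OF S(2), where n = n] above[of x] above[of y]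
      z le_trans le_antisym by (metis insertCI)
  then show "\<exists>n. ?a n x = ?a n y"
    by (intro exI[of _ "Suc n"]) simp
qed

end


section \<open>The visibility preorder\<close>

lemma fold_measurable:
  assumes "\<And>i. g i \<in> measurable M M"
  shows "fold g s \<in> measurable M M"
proof (induction s)
  case (Cons i s)
  then show ?case using assms by (simp add: measurable_comp)
qed (simp add: id_def)

text \<open>The word \<open>s\<close> of generators describes a path starting at \<open>x\<close>, possibly with pauses.\<close>

lemma rtrancl_iff_fold:
  fixes g :: "nat \<Rightarrow> 'a \<Rightarrow> 'a"
  assumes g: "\<And>x. x \<in> X \<Longrightarrow> range (\<lambda>i. g i x) = insert x (G `` {x})"
    and G: "G \<subseteq> X \<times> X" and x: "x \<in> X" "x \<in> V"
  shows "(x, y) \<in> (G \<inter> V \<times> V)\<^sup>* \<longleftrightarrow> (\<exists>s. y = fold g s x \<and> (\<forall>k\<le>length s. fold g (take k s) x \<in> V))"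
proof
  assume "(x, y) \<in> (G \<inter> V \<times> V)\<^sup>*"
  then show "\<exists>s. y = fold g s x \<and> (\<forall>k\<le>length s. fold g (take k s) x \<in> V)"
  proof (induction rule: rtrancl_induct)
    case base
    show ?case using x by (intro exI[of _ "[]"]) simp
  next
    case (step y z)
    then obtain s where s: "y = fold g s x" "\<And>k. k \<le> length s \<Longrightarrow> fold g (take k s) x \<in> V"
      by blast
    have "z \<in> range (\<lambda>i. g i y)"
      using step(2) g[of y] G by auto
    then obtain i where i: "z = g i y" by blast
    have "fold g (take k (s @ [i])) x \<in> V" if "k \<le> length (s @ [i])" for k
      using that s i step(2) by (cases "k \<le> length s") (auto simp: not_le Suc_le_eq)
    then show ?case
      using s(1) i by (intro exI[of _ "s @ [i]"]) auto
  qed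
next
  assume "\<exists>s. y = fold g s x \<and> (\<forall>k\<le>length s. fold g (take k s) x \<in> V)"
  then obtain s where "y = fold g s x" "\<forall>k\<le>length s. fold g (take k s) x \<in> V"
    by blast
  then show "(x, y) \<in> (G \<inter> V \<times> V)\<^sup>*"
  proof (induction s arbitrary: y rule: rev_induct)
    case (snoc i s)
    define z where "z = fold g s x"
    have V: "\<forall>k\<le>length s. fold g (take k s) x \<in> V"
    proof (intro allI impI)
      fix k assume "k \<le> length s"
      then show "fold g (take k s) x \<in> V"
        using snoc.prems(2)[rule_format, of k] by simp
    qed
    then have xz: "(x, z) \<in> (G \<inter> V \<times> V)\<^sup>*"
      using snoc.IH[of z] by (simp add: z_def)
    have "z \<in> V" using V[rule_format, of "length s"] by (simp add: z_def)
    have "z \<in> X"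
      using xz x(1) G by (cases rule: rtranclE) auto
    have "y = g i z" using snoc.prems(1) by (simp add: z_def)
    moreover have "y \<in> V"
      using snoc.prems(1) snoc.prems(2)[rule_format, of "length (s @ [i])"] by simp
    ultimately have "y = z \<or> (z, y) \<in> G \<inter> V \<times> V"
      using g[OF \<open>z \<in> X\<close>] \<open>z \<in> V\<close> by blast
    then show ?case using xz by (meson rtrancl.rtrancl_into_rtrancl)
  qed simp
qed

lemma conn_rel_equiv:
  assumes "sym G"
  shows "equiv X (conn_rel X G)"
proof (rule equivI)
  show "conn_rel X G \<subseteq> X \<times> X" "refl_on X (conn_rel X G)"
    by (auto simp: conn_rel_def refl_on_def)
  show "sym (conn_rel X G)"
    using sym_rtrancl[OF assms] by (auto simp: conn_rel_def sym_def)
  show "trans (conn_rel X G)"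
    by (auto simp: conn_rel_def trans_def)
qed

text \<open>The component of x in its sublevel set is itself a visible neighborhood and contains all
  others. This trades a quantifier over sets for one over paths.\<close>

lemma visible_from_iff:
  assumes "sym G" "G \<subseteq> X \<times> X" "x \<in> X" "w x x \<le> 1"
  shows "visible_from X G w x y \<longleftrightarrow> (x, y) \<in> (G \<inter> {v. w x v \<le> 1} \<times> {v. w x v \<le> 1})\<^sup>*"
proof
  let ?H = "G \<inter> {v. w x v \<le> 1} \<times> {v. w x v \<le> 1}"
  assume "visible_from X G w x y"
  then obtain V where V: "x \<in> V" "graph_connected G V" "\<forall>v\<in>V. w x v \<le> 1" "y \<in> V"
    unfolding visible_from_def visible_nbhd_def by blast
  then have "(x, y) \<in> (G \<inter> V \<times> V)\<^sup>*"
    by (auto simp: graph_connected_def)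
  moreover have "G \<inter> V \<times> V \<subseteq> ?H"
    using V by auto
  ultimately show "(x, y) \<in> ?H\<^sup>*"
    using rtrancl_mono by blast
next
  let ?H = "G \<inter> {v. w x v \<le> 1} \<times> {v. w x v \<le> 1}"
  assume xy: "(x, y) \<in> ?H\<^sup>*"
  define V where "V = ?H\<^sup>* `` {x}"
  have H: "v \<in> X \<and> w x v \<le> 1" if "(x, v) \<in> ?H\<^sup>*" for v
    using that assms by (cases rule: rtranclE) auto
  have path: "(x, v) \<in> (G \<inter> V \<times> V)\<^sup>*" if "(x, v) \<in> ?H\<^sup>*" for v
    using that
  proof (induction rule: rtrancl_induct)
    case (step y z)
    then have "(x, z) \<in> ?H\<^sup>*" by (meson rtrancl.rtrancl_into_rtrancl)
    then have "(y, z) \<in> G \<inter> V \<times> V" using step by (auto simp: V_def)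
    with step show ?case by (meson rtrancl.rtrancl_into_rtrancl)
  qed simp
  have "sym (G \<inter> V \<times> V)"
    using assms(1) by (auto simp: sym_def)
  then have symr: "(v, x) \<in> (G \<inter> V \<times> V)\<^sup>*" if "(x, v) \<in> (G \<inter> V \<times> V)\<^sup>*" for v
    using that sym_rtrancl by (metis symD)
  have "graph_connected G V"
    unfolding graph_connected_def
  proof (intro ballI)
    fix u v assume "u \<in> V" "v \<in> V"
    then have "(x, u) \<in> ?H\<^sup>*" "(x, v) \<in> ?H\<^sup>*" by (auto simp: V_def)
    then show "(u, v) \<in> (G \<inter> V \<times> V)\<^sup>*"
      using path symr rtrancl_trans by metis
  qed
  moreover have "x \<in> V" "y \<in> V"
    using xy by (simp_all add: V_def)
  moreover have "v \<in> X \<and> w x v \<le> 1" if "v \<in> V" for v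
    by (rule H) (use that in \<open>simp add: V_def\<close>)
  ultimately show "visible_from X G w x y"
    unfolding visible_from_def visible_nbhd_def by (intro exI[of _ V]) auto
qed

lemma summable_on_imp_finite_ge:
  fixes f :: "'a \<Rightarrow> real"
  assumes f: "f summable_on A" and pos: "\<And>x. x \<in> A \<Longrightarrow> 0 \<le> f x" and "0 < \<epsilon>"
  shows "finite {x \<in> A. \<epsilon> \<le> f x}"
proof (rule ccontr)
  assume inf: "infinite {x \<in> A. \<epsilon> \<le> f x}"
  obtain n :: nat where n: "infsum f A < real n * \<epsilon>"
    using reals_Archimedean3[OF \<open>0 < \<epsilon>\<close>] by blast
  obtain B where B: "B \<subseteq> {x \<in> A. \<epsilon> \<le> f x}" "finite B" "card B = n"
    using infinite_arbitrarily_large[OF inf] by blast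
  have "real n * \<epsilon> = (\<Sum>x\<in>B. \<epsilon>)"
    using B(3) by simp
  also have "\<dots> \<le> sum f B"
    using B(1) by (intro sum_mono) auto
  also have "\<dots> \<le> infsum f A"
    using B(1,2) pos by (intro finite_sum_le_infsum[OF f]) auto
  finally show False using n by simp
qed

section \<open>Combinatorics of visibility, without measurability\<close>

locale visibility_graph =
  fixes X :: "'a set" and G :: "('a \<times> 'a) set" and w :: "'a \<Rightarrow> 'a \<Rightarrow> real"
  assumes G_sym: "sym G" and G_sub: "G \<subseteq> X \<times> X"
    and cocycle: "cocycle (conn_rel X G) w" and fin_vis: "finite_visibility X G w"
begin

abbreviation E where "E \<equiv> conn_rel X G"

definition below :: "'a \<Rightarrow> ('a \<times> 'a) set" where
  "below x = G \<inter> {v. w x v \<le> 1} \<times> {v. w x v \<le> 1}"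

definition sees :: "'a \<Rightarrow> 'a \<Rightarrow> bool" where
  "sees x y \<longleftrightarrow> x \<in> X \<and> (x, y) \<in> (below x)\<^sup>*"

lemma E_space: "(x, y) \<in> E \<Longrightarrow> x \<in> X \<and> y \<in> X"
  by (auto simp: conn_rel_def)

lemma E_refl: "x \<in> X \<Longrightarrow> (x, x) \<in> E"
  by (auto simp: conn_rel_def)

lemma E_sym: "(x, y) \<in> E \<Longrightarrow> (y, x) \<in> E"
  using conn_rel_equiv[OF G_sym] by (auto simp: equiv_def sym_def)

lemma E_trans: "(x, y) \<in> E \<Longrightarrow> (y, z) \<in> E \<Longrightarrow> (x, z) \<in> E"
  by (auto simp: conn_rel_def)

lemma G_E: "(x, y) \<in> G \<Longrightarrow> (x, y) \<in> E"
  using G_sub by (auto simp: conn_rel_def)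

lemma w_pos: "(x, y) \<in> E \<Longrightarrow> 0 < w x y"
  using cocycle by (auto simp: cocycle_def)

lemma w_mult: "(x, y) \<in> E \<Longrightarrow> (y, z) \<in> E \<Longrightarrow> w x z = w x y * w y z"
  using cocycle unfolding cocycle_def by metis

lemma w_refl: "x \<in> X \<Longrightarrow> w x x = 1"
  using w_mult[of x x x] w_pos[of x x] E_refl[of x] by simp

lemma w_inverse: "(x, y) \<in> E \<Longrightarrow> w x y * w y x = 1"
  using w_mult[of x y x] w_refl[of x] E_sym E_space by metis

lemma visible_from_sees: "x \<in> X \<Longrightarrow> visible_from X G w x y \<longleftrightarrow> sees x y"
  using visible_from_iff[OF G_sym G_sub] w_refl by (simp add: sees_def below_def)

lemma sees_E: "sees x y \<Longrightarrow> (x, y) \<in> E"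
proof -
  assume s: "sees x y"
  then have "(x, y) \<in> (below x)\<^sup>*" "x \<in> X" by (auto simp: sees_def)
  then show ?thesis
    by (induction rule: rtrancl_induct) (auto simp: below_def intro: E_refl E_trans G_E)
qed

lemma sees_le: "sees x y \<Longrightarrow> w x y \<le> 1"
  unfolding sees_def using w_refl[of x] by (auto elim!: rtranclE simp: below_def)

lemma sees_refl: "x \<in> X \<Longrightarrow> sees x x"
  by (simp add: sees_def)

lemma below_sym: "sym ((below x)\<^sup>*)"
  using G_sym by (intro sym_rtrancl) (auto simp: below_def sym_def)

text \<open>From \<open>w x v = w x y * w y v\<close>. Values of \<open>w\<close> between unrelated
  points are arbitrary, so the inclusion is claimed only for edges that start in the class of
  y.\<close>

lemma below_mono:
  assumes "(x, y) \<in> E" "w x y \<le> 1"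
  shows "below y \<subseteq> below x \<union> - (E `` {y} \<times> UNIV)"
proof -
  have "w x v \<le> 1" if "(y, v) \<in> E" "w y v \<le> 1" for v
    using w_mult[OF assms(1) that(1)] mult_le_one[OF assms(2) _ that(2)] w_pos[OF that(1)] by simp
  then show ?thesis
    using G_E E_trans by (fastforce simp: below_def)
qed

text \<open>Only the weight of y is bounded, x need not see y: linearity and directedness use the
  path before its endpoints are joined to x.\<close>

lemma sees_weaken:
  assumes "(x, y) \<in> E" "w x y \<le> 1" "sees y z"
  shows "(y, z) \<in> (below x)\<^sup>*"
proof -
  have "(y, z) \<in> (below y)\<^sup>*" using assms(3) by (simp add: sees_def)
  then show ?thesis
  proof (induction rule: rtrancl_induct)
    case (step u v)
    have "(y, u) \<in> E"
      using step(1) E_space[OF assms(1)] sees_E[of y u] by (simp add: sees_def)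
    then have "(u, v) \<in> below x"
      using below_mono[OF assms(1,2)] step(2) by blast
    with step(3) show ?case by (meson rtrancl.rtrancl_into_rtrancl)
  qed simp
qed

lemma sees_trans: "sees x y \<Longrightarrow> sees y z \<Longrightarrow> sees x z"
  using sees_weaken[OF sees_E sees_le] unfolding sees_def by (meson rtrancl_trans)

text \<open>The weights \<open>w y z\<close> and \<open>w z y\<close> are reciprocal, so one is at
  most 1, say the former. Then the path from z to x stays in the sublevel set of y, and reversed it
  continues the path from y to x.\<close>

lemma sees_linear:
  assumes "sees y x" "sees z x"
  shows "sees y z \<or> sees z y"
proof -
  have *: "sees y z" if "sees y x" "sees z x" "w y z \<le> 1" for y z
  proof -
    have "(y, z) \<in> E" using sees_E[OF that(1)] sees_E[OF that(2)] E_sym E_trans by blast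
    then have "(z, x) \<in> (below y)\<^sup>*" using sees_weaken that by blast
    then have "(x, z) \<in> (below y)\<^sup>*" using below_sym by (metis symD)
    then show ?thesis using that(1) unfolding sees_def by (meson rtrancl_trans)
  qed
  have E: "(y, z) \<in> E" using sees_E[OF assms(1)] sees_E[OF assms(2)] E_sym E_trans by blast
  have "w y z \<le> 1 \<or> w z y \<le> 1"
    using w_inverse[OF E] w_pos[OF E] mult_strict_mono[of 1 "w y z" 1 "w z y"] by fastforce
  then show ?thesis
    using *[OF assms] *[OF assms(2,1)] by blast
qed

text \<open>For y in between, \<open>w z x = w z y * w y x \<le> w z y\<close>. A convergent sum has
  only finitely many terms of at least the positive size \<open>w z x\<close>.\<close>

lemma sees_finite:
  assumes "sees z x"
  shows "finite {y. sees y x \<and> sees z y}"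
proof -
  have "z \<in> X" using assms by (simp add: sees_def)
  then have "{y. visible_from X G w z y} = {y. sees z y}"
    using visible_from_sees by simp
  then have "(\<lambda>y. w z y) summable_on {y. sees z y}"
    using fin_vis \<open>z \<in> X\<close> unfolding finite_visibility_def by metis
  moreover have "0 < w z x"
    using w_pos[OF sees_E[OF assms]] .
  ultimately have "finite {y \<in> {y. sees z y}. w z x \<le> w z y}"
    using w_pos[OF sees_E] by (intro summable_on_imp_finite_ge) (auto intro: less_imp_le)
  moreover have "{y. sees y x \<and> sees z y} \<subseteq> {y \<in> {y. sees z y}. w z x \<le> w z y}"
  proof
    fix y assume "y \<in> {y. sees y x \<and> sees z y}"
    then have y: "sees y x" "sees z y" by auto
    have "w z x = w z y * w y x" by (rule w_mult[OF sees_E[OF y(2)] sees_E[OF y(1)]])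
    also have "\<dots> \<le> w z y * 1"
      using sees_le[OF y(1)] w_pos[OF sees_E[OF y(2)]] by (intro mult_left_mono) auto
    finally show "y \<in> {y \<in> {y. sees z y}. w z x \<le> w z y}" using y by simp
  qed
  ultimately show ?thesis by (rule rev_finite_subset)
qed

text \<open>Along a path from x, a point z that sees everything so far is kept while its threshold
  suffices; otherwise the new vertex itself takes over.\<close>

lemma sees_directed:
  assumes "(x, y) \<in> E"
  shows "\<exists>z. sees z x \<and> sees z y"
proof -
  have "(x, y) \<in> G\<^sup>*" "x \<in> X" using assms by (auto simp: conn_rel_def)
  then show ?thesis
  proof (induction rule: rtrancl_induct)
    case base
    then show ?case using sees_refl by blast
  next
    case (step y y')
    then obtain z where z: "sees z x" "sees z y" by blast
    have E: "(z, y) \<in> E" "(y, y') \<in> E" "(z, y') \<in> E"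
      using sees_E[OF z(2)] G_E[OF step(2)] E_trans by blast+
    show ?case
    proof (cases "w z y' \<le> 1")
      case True
      then have "(y, y') \<in> below z"
        using step(2) sees_le[OF z(2)] by (simp add: below_def)
      then have "sees z y'"
        using z(2) unfolding sees_def by (meson rtrancl.rtrancl_into_rtrancl)
      with z show ?thesis by blast
    next
      \<comment> \<open>Now z lies below the threshold of y', hence so does all that z sees. The
        edge to y followed by the reversed path from z to y shows that y' sees z.\<close>
      case False
      then have le: "w y' z \<le> 1"
        using w_inverse[OF E(3)] w_pos[OF E(3)] by (smt (verit) mult_less_cancel_right1)
      have "w y' y \<le> 1"
        using w_mult[OF E_sym[OF E(3)] E(1)] le sees_le[OF z(2)] w_pos[OF E(1)]
          mult_le_one[OF le _ sees_le[OF z(2)]] by simp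
      then have "(y', y) \<in> below y'"
        using step(2) G_sym w_refl E_space[OF E(2)] by (auto simp: below_def dest: symD)
      moreover have "(y, z) \<in> (below y')\<^sup>*"
        using sees_weaken[OF E_sym[OF E(3)] le z(2)] below_sym by (metis symD)
      ultimately have "sees y' z"
        using E_space[OF E(2)] unfolding sees_def by (meson converse_rtrancl_into_rtrancl)
      then show ?thesis
        using z(1) sees_trans sees_refl E_space[OF E(2)] by blast
    qed
  qed
qed

end


section \<open>From the Borel graph to a Borel forest order\<close>

theorem theorem1p8:
  fixes M :: "'a measure"
    and G :: "('a \<times> 'a) set"
    and w :: "'a \<Rightarrow> 'a \<Rightarrow> real"
  assumes "standard_borel M"
    and "borel_graph M G"
    and "locally_countable M G"
    and "borel_cocycle M (conn_rel (space M) G) w"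
    and "finite_visibility (space M) G w"
  shows "hyperfinite_graph M G"
proof (cases "space M = {}")
  \<comment> \<open>The empty space is treated apart because the retraction onto \<open>M\<close>
    needs a point as its default value.\<close>
  case True
  then show ?thesis
    unfolding hyperfinite_graph_def
    by (intro exI[of _ "\<lambda>_. {}"]) (auto simp: conn_rel_def equiv_def refl_on_def sym_def trans_def incseq_def)
next
  case False
  let ?X = "space M" and ?E = "conn_rel (space M) G"
  have G: "G \<in> sets (M \<Otimes>\<^sub>M M)" "sym G"
    using assms(2) by (auto simp: borel_graph_def)
  have Gsub: "G \<subseteq> ?X \<times> ?X"
    using sets.sets_into_space[OF G(1)] by (simp add: space_pair_measure)
  have w: "cocycle ?E w" and w_meas: "(\<lambda>(x, y). w x y) \<in> borel_measurable (restrict_space (M \<Otimes>\<^sub>M M) ?E)"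
    using assms(4) by (auto simp: borel_cocycle_def)
  interpret V: visibility_graph ?X G w
    using G(2) Gsub w assms(5) by unfold_locales
  obtain c :: "'a \<Rightarrow> nat \<Rightarrow> real" and r where c [measurable]: "c \<in> borel_measurable M"
      and r: "r \<in> measurable borel M" and rc: "\<And>x. x \<in> ?X \<Longrightarrow> r (c x) = x"
    using standard_borel_retract[OF assms(1) False] by blast
  have count: "countable (G `` {x})" if "x \<in> ?X" for x
    using assms(3) that by (simp add: locally_countable_def)
  obtain g :: "nat \<Rightarrow> 'a \<Rightarrow> 'a" where g': "\<forall>i. g i \<in> measurable M M"
      "\<forall>x\<in>?X. range (\<lambda>i. g i x) = insert x (G `` {x})"
    by (rule Lusin_Novikov_standard_borel[OF c r rc G(1) count])
  note g_meas = g'(1)[rule_format] and g = g'(2)[rule_format]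
  have f_meas [measurable]: "fold g s \<in> measurable M M" for s
    by (rule fold_measurable[OF g_meas])
  have star_fold: "(x, y) \<in> G\<^sup>* \<longleftrightarrow> (\<exists>s. y = fold g s x)" if "x \<in> ?X" for x y
    using rtrancl_iff_fold[OF g Gsub that, of UNIV y] by simp
  have f_E: "(x, fold g s x) \<in> ?E" if "x \<in> ?X" for x s
    using star_fold[OF that] measurable_space[OF f_meas that] that unfolding conn_rel_def by blast
  have E_fold: "(x, y) \<in> ?E \<longleftrightarrow> (\<exists>s. y = fold g s x)" if "x \<in> ?X" for x y
    using star_fold[OF that] f_E[OF that] unfolding conn_rel_def by blast
  define e where "e = (\<lambda>n. fold g (from_nat n))"
  interpret B: countable_borel_eqrel M ?E e c
  proof
    show "equiv ?X ?E" by (rule conn_rel_equiv[OF G(2)])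
    show "e i \<in> measurable M M" for i by (simp add: e_def f_meas)
    show "(x, y) \<in> ?E \<longleftrightarrow> (\<exists>i. y = e i x)" if "x \<in> ?X" for x y
      unfolding E_fold[OF that] e_def by (metis from_nat_to_nat)
    show "c \<in> borel_measurable M" by (rule c)
    show "inj_on c ?X" by (rule inj_on_inverseI[of _ r]) (rule rc)
  qed
  have c_coord [measurable]: "(\<lambda>x. c x k) \<in> borel_measurable M" for k
    using measurable_compose[OF c measurable_product_coordinates] by simp
  have E_meas: "?E \<in> sets (M \<Otimes>\<^sub>M M)"
  proof -
    have [measurable]: "Measurable.pred (M \<Otimes>\<^sub>M M) (\<lambda>p. snd p = fold g s (fst p))" for s
      by (rule B.pred_eq) measurable
    have "{p \<in> space (M \<Otimes>\<^sub>M M). \<exists>s. snd p = fold g s (fst p)} \<in> sets (M \<Otimes>\<^sub>M M)"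
      by measurable
    moreover have "?E = {p \<in> space (M \<Otimes>\<^sub>M M). \<exists>s. snd p = fold g s (fst p)}"
    proof (intro set_eqI)
      fix p
      show "p \<in> ?E \<longleftrightarrow> p \<in> {p \<in> space (M \<Otimes>\<^sub>M M). \<exists>s. snd p = fold g s (fst p)}"
        using E_fold[of "fst p" "snd p"] V.E_space[of "fst p" "snd p"]
        unfolding space_pair_measure mem_Collect_eq mem_Times_iff prod.collapse by blast
    qed
    ultimately show ?thesis by simp
  qed
  \<comment> \<open>The cocycle is measurable on \<open>?E\<close> only, so it is evaluated along
    the maps x to (x, \<open>fold g s x\<close>), which take values there.\<close>
  have wf_meas [measurable]: "(\<lambda>x. w x (fold g s x)) \<in> borel_measurable M" for s
  proof -
    have "(\<lambda>x. (x, fold g s x)) \<in> measurable M (restrict_space (M \<Otimes>\<^sub>M M) ?E)"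
      by (rule measurable_restrict_space2) (use f_E in auto)
    from measurable_compose[OF this w_meas] show ?thesis by simp
  qed
  have sees_iff: "V.sees x y \<longleftrightarrow> (\<exists>s. y = fold g s x \<and> (\<forall>k. k \<le> length s \<longrightarrow> w x (fold g (take k s) x) \<le> 1))"
    if "x \<in> ?X" for x y
    using rtrancl_iff_fold[OF g Gsub that, of "{v. w x v \<le> 1}" y] V.w_refl[OF that] that
    by (simp add: V.sees_def V.below_def)
  have sees_meas: "Measurable.pred (M \<Otimes>\<^sub>M M) (\<lambda>(x, y). V.sees x y)"
  proof -
    have [measurable]: "Measurable.pred (M \<Otimes>\<^sub>M M) (\<lambda>p. snd p = fold g s (fst p))" for s
      by (rule B.pred_eq) measurable
    have [measurable]: "Measurable.pred (M \<Otimes>\<^sub>M M) (\<lambda>p. w (fst p) (fold g s (fst p)) \<le> 1)" for s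
      using measurable_compose[OF measurable_fst wf_meas[of s]] by measurable
    have "Measurable.pred (M \<Otimes>\<^sub>M M) (\<lambda>p. \<exists>s. snd p = fold g s (fst p) \<and>
        (\<forall>k. k \<le> length s \<longrightarrow> w (fst p) (fold g (take k s) (fst p)) \<le> 1))"
      by measurable
    moreover have "(case p of (x, y) \<Rightarrow> V.sees x y) \<longleftrightarrow> (\<exists>s. snd p = fold g s (fst p) \<and>
        (\<forall>k. k \<le> length s \<longrightarrow> w (fst p) (fold g (take k s) (fst p)) \<le> 1))"
      if "p \<in> space (M \<Otimes>\<^sub>M M)" for p
      using that sees_iff[of "fst p" "snd p"] by (auto simp: space_pair_measure)
    ultimately show ?thesis
      by (simp cong: measurable_cong)
  qed
  \<comment> \<open>The point that sees is the upper one. Points that see each other are tied, and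
    the lexicographic order of their codes decides; it compares any two distinct sequences at their
    first difference.\<close>
  define le where "le = (\<lambda>x y. V.sees y x \<and> (V.sees x y \<longrightarrow> \<not> less_fun (c y) (c x)))"
  have tri: "less_fun (c x) (c y) \<or> c x = c y \<or> less_fun (c y) (c x)" for x y
  proof (cases "c x = c y")
    case False
    then obtain k where k: "c x k \<noteq> c y k" by blast
    define l where "l = (LEAST k. c x k \<noteq> c y k)"
    have "c x l \<noteq> c y l"
      unfolding l_def by (rule LeastI) (rule k)
    moreover have "c x i = c y i" if "i < l" for i
      using not_less_Least[OF that[unfolded l_def]] by blast
    ultimately show ?thesis
      unfolding less_fun_def by (cases "c x l < c y l") (auto intro!: exI[of _ l])
  qed simp
  have le_or: "le x y \<or> le y x" if "V.sees x y" for x y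
    using that less_fun_asym[of "c x" "c y"] unfolding le_def by blast
  interpret F: borel_forest M ?E e c le
  proof
    have [measurable]: "Measurable.pred (M \<Otimes>\<^sub>M M) (\<lambda>p. V.sees (fst p) (snd p))"
        "Measurable.pred (M \<Otimes>\<^sub>M M) (\<lambda>p. V.sees (snd p) (fst p))"
      by (rule B.pred_pair[OF sees_meas]; measurable)+
    have [measurable]: "Measurable.pred (M \<Otimes>\<^sub>M M) (\<lambda>p. less_fun (c (snd p)) (c (fst p)))"
      unfolding less_fun_def by measurable
    show "Measurable.pred (M \<Otimes>\<^sub>M M) (\<lambda>(x, y). le x y)"
      unfolding le_def case_prod_unfold by measurable
    show "le x y \<Longrightarrow> (x, y) \<in> ?E" for x y
      using V.sees_E V.E_sym by (auto simp: le_def)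
    show "x \<in> ?X \<Longrightarrow> le x x" for x
      by (simp add: le_def V.sees_refl less_fun_irrefl)
    show "x = y" if "le x y" "le y x" for x y
    proof -
      have "c x = c y"
        using that tri[of x y] by (auto simp: le_def)
      moreover have "x \<in> ?X" "y \<in> ?X"
        using that by (auto simp: le_def V.sees_def)
      ultimately show ?thesis
        using inj_onD[OF B.c_inj] by blast
    qed
    show "le x z" if "le x y" "le y z" for x y z
    proof -
      \<comment> \<open>If x also sees z, then x, y and z are all tied, and the claim reduces to
        transitivity of the lexicographic order.\<close>
      have "\<not> less_fun (c z) (c x)" if "V.sees x z"
      proof -
        have "V.sees x y" "V.sees y z"
          using \<open>le x y\<close> \<open>le y z\<close> \<open>V.sees x z\<close> V.sees_trans by (auto simp: le_def)
        then have "\<not> less_fun (c y) (c x)" "\<not> less_fun (c z) (c y)"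
          using \<open>le x y\<close> \<open>le y z\<close> by (auto simp: le_def)
        then show ?thesis
          using tri[of x y] less_fun_trans[of "c z" "c x" "c y"] by auto
      qed
      then show ?thesis
        using that V.sees_trans by (auto simp: le_def)
    qed
    show "le y z \<or> le z y" if "le x y" "le x z" for x y z
      using that V.sees_linear[of y x z] le_or unfolding le_def by blast
    show "finite {y. le x y \<and> le y z}" if "le x z" for x z
    proof (rule finite_subset)
      show "{y. le x y \<and> le y z} \<subseteq> {y. V.sees y x \<and> V.sees z y}"
        by (auto simp: le_def)
      show "finite {y. V.sees y x \<and> V.sees z y}"
        using that by (intro V.sees_finite) (simp add: le_def)
    qed
    show "\<exists>z. le x z \<and> le y z" if xy: "(x, y) \<in> ?E" for x y
    proof -
      have refl: "le x x" "le y y"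
        using V.E_space[OF xy] by (simp_all add: le_def V.sees_refl less_fun_irrefl)
      have comp: ?thesis if "V.sees x y \<or> V.sees y x"
        using that le_or refl by blast
      obtain z where z: "V.sees z x" "V.sees z y"
        using V.sees_directed[OF xy] by blast
      show ?thesis
      \<comment> \<open>Among tied points z may lose on codes. But if x or y sees z, then one of x
        and y sees the other and they are comparable; if neither does, there is no tie and z lies
        above both.\<close>
      proof (cases "V.sees x z \<or> V.sees y z")
        case True
        then show ?thesis using comp z V.sees_trans by blast
      next
        case False
        then show ?thesis using z unfolding le_def by blast
      qed
    qed
  qed
  show ?thesis
    using F.hyperfinite unfolding hyperfinite_graph_def hyperfinite_eqrel_def .
qed

end
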